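(* Let $(T,\mathcal{A},\mu)$ be a complete finite measure space, let $\Phi:T\times\mathbb{R}^n\rightrightarrows\mathbb{R}^m$ be a set-valued normal integrand, and let $(\bar x,\bar y)\in\operatorname{gph}E_\Phi$. Suppose that $\Phi$ is integrably bounded: there exist $\rho>0$ and $\kappa\in L^1(T,\mathbb{R}_+)$ with $\Phi_t(x)\subset\kappa(t)\mathbb{B}$ for all $x\in\mathbb{B}_\rho(\bar x)$ and a.e. $t\in T$. Suppose that for some neighborhood $U$ of $\bar x$ $$\Phi_t(x)=F(t,g_t(x))\quad\text{for all }x\in U\text{ and a.e. }t\in T,\qquad F(t,z):=\{y\in\mathbb{R}^m:\varphi^i_t(z,y)\le0\text{ for all }i\in I\},$$ where $I$ is finite, $\varphi^i:T\times\mathbb{R}^q\times\mathbb{R}^m\to\mathbb{R}$, $i\in I$, are convex normal integrands such that for a.e. $t\in T$ the functions $\varphi^i_t(z,y)$ are continuously differentiable in $(z,y)$ around the reference points (the points $(g_t(x),y)$ with $x$ near $\bar x$ and $y\in F_t(g_t(x))$), and where $g:T\times U\to\mathbb{R}^q$ is measurable in $t$ and continuously differentiable in $x$ with $$\sup\{\|\nabla g_t(x)\|:(t,x)\in T\times U\}<\infty.$$ Assume further that the integral triviality qualification condition (ITQC) holds at $\bar x$ and that the integrable Slater constraint qualification is satisfied at $\mathsf{z}$ given by $\mathsf{z}(t):=g_t(\bar x)$. Then for every $\bar{\mathsf y}\in\mathcal{S}_\Phi(\bar x,\bar y)$ and every $y^*\in\mathbb{R}^m$ $$\hat D^*E_\Phi(\bar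 x,\bar y)(y^* )\subset\int_T\nabla g_t(\bar x)^*\circ D^*F_t(g_t(\bar x),\bar{\mathsf y}(t))(y^* )\,d\mu,$$ where $$D^*F_t(g_t(\bar x),\bar{\mathsf y}(t))(y^* )=\Big\{z^*\in\mathbb{R}^q:\ (z^*,-y^* )=\sum_{i\in I_t(\bar x,\bar{\mathsf y}(t))}\lambda_i\nabla\varphi^i_t(g_t(\bar x),\bar{\mathsf y}(t))\ \text{for some }\lambda_i\ge0,\ i\in I_t(\bar x,\bar{\mathsf y}(t))\Big\}\qquad( * )$$ (for a.e. $t\in T$). If in addition $\mathcal{S}_\Phi$ is inner semicompact at $(\bar x,\bar y)$, then for every $y^*\in\mathbb{R}^m$ $$D^*E_\Phi(\bar x,\bar y)(y^* )\subset\bigcup_{\bar{\mathsf y}\in\mathcal{S}_\Phi(\bar x,\bar y)}\int_T\nabla g_t(\bar x)^*\circ D^*F_t(g_t(\bar x),\bar{\mathsf y}(t))(y^* )\,d\mu,$$ where $D^*F_t(g_t(\bar x),\bar{\mathsf y}(t))$ is computed by $( * )$.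
   Context: $\mathbb{R}_+:=\{\alpha\in\mathbb{R}:\alpha>0\}$; $\mathbb{B}_r(\cdot)$ is the closed ball, $\mathbb{B}$ the closed unit ball. $\Phi_t:=\Phi(t,\cdot)$, $F_t:=F(t,\cdot)$, $g_t:=g(t,\cdot)$, $\varphi^i_t:=\varphi^i(t,\cdot,\cdot)$; $\nabla g_t(x)^*$ is the transpose Jacobian and $\nabla g_t(\bar x)^*\circ A=\{\nabla g_t(\bar x)^*z^*:z^*\in A\}$. $\Phi$ is a set-valued normal integrand if $\operatorname{gph}\Phi_t$ is closed for all $t$ and $\operatorname{gph}\Phi\in\mathcal{A}\otimes\mathcal{B}(\mathbb{R}^n\times\mathbb{R}^m)$. A convex normal integrand is a jointly ($\mathcal{A}\otimes$ Borel) measurable function that is lower semicontinuous and convex in its vector variable for every $t$. The (Aumann) integral of $A:T\rightrightarrows\mathbb{R}^d$ is $\int_TA(t)d\mu=\{\int_T\mathsf{v}\,d\mu:\mathsf{v}\in L^1(T,\mathbb{R}^d),\ \mathsf{v}(t)\in A(t)\text{ a.e.}\}$. $E_\Phi(x):=\int_T\Phi_t(x)d\mu$. $\mathcal{S}_\Phi(x,y):=\{\mathsf{y}\in L^1(T,\mathbb{R}^m):\int_T\mathsf{y}\,d\mu=y,\ \mathsf{y}(t)\in\Phi_t(x)\text{ for a.e. }t\}$. $\mathcal{S}_\Phi$ is inner semicompact at $(\bar x,\bar y)$ if for every sequence $(x_k,y_k)\to(\bar x,\bar y)$ with $\mathcal{S}_\Phi(x_k,y_k)\neq\emptyset$ there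 is a sequence $\mathsf{y}_k\in\mathcal{S}_\Phi(x_k,y_k)$ containing an $L^1(T,\mathbb{R}^m)$-norm convergent subsequence. Regular normal cone: $\hat N(\bar z;\Omega)=\{z^*:\limsup_{z\to\bar z,z\in\Omega}\langle z^*,z-\bar z\rangle/\|z-\bar z\|\le0\}$ for $\bar z\in\Omega$, $\emptyset$ otherwise. Limiting normal cone: $N(\bar z;\Omega)=\{z^*:\exists z_k\to\bar z,\ z_k^*\to z^*,\ z_k^*\in\hat N(z_k;\Omega)\}$. Coderivatives at $(x,y)\in\operatorname{gph}G$: $\hat D^*G(x,y)(y^* )=\{x^*:(x^*,-y^* )\in\hat N((x,y);\operatorname{gph}G)\}$, $D^*G(x,y)(y^* )=\{x^*:(x^*,-y^* )\in N((x,y);\operatorname{gph}G)\}$. Active indices: $I_t(x,y):=\{i\in I:\varphi^i_t(g_t(x),y)=0\}$. Integrable Slater constraint qualification at a measurable $\mathsf{z}:T\to\mathbb{R}^q$: there is $\eta>0$ such that for all $h\in\eta\mathbb{B}$ there exists $\mathsf{y}\in L^1(T,\mathbb{R}^m)$ with $\varphi^i_t(\mathsf{z}(t)+h,\mathsf{y}(t))<0$ for all $i\in I$ and a.e. $t\in T$. ITQC at $\bar x$: there exists $\eta>0$ such that for all $x\in\mathbb{B}_\eta(\bar x)$, a.e. $t\in T$, and all $y\in F_t(g_t(x))$, the adjoint system $(z^*,0)=\sum_{i\in I_t(x,y)}\lambda_i\nabla\varphi^i_t(g_t(x),y)$, $\lambda_i\ge0$, $\nabla g_t(x)^*z^*=0$,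 admits only the trivial solution $z^*=0$. *)

theory Defs
  imports "HOL-Analysis.Analysis"
begin

section \<open>Normal cones and coderivatives\<close>

text \<open>Set-valued maps are functions into sets; \<open>x \<mapsto> {}\<close> is allowed.\<close>

definition gph :: "('a \<Rightarrow> 'b set) \<Rightarrow> ('a \<times> 'b) set" where
  "gph G = {(x, y). y \<in> G x}"

text \<open>The filter \<open>at zbar within \<Omega>\<close> omits \<open>zbar\<close>, where the quotient is undefined.
  At an isolated point of \<open>\<Omega>\<close> the upper limit is \<open>-\<infinity>\<close>, so the cone is the whole space.\<close>

definition regular_normal_cone :: "'a::real_inner \<Rightarrow> 'a set \<Rightarrow> 'a set" where
  "regular_normal_cone zbar \<Omega> =
    (if zbar \<in> \<Omega>
     then {zs. Limsup (at zbar within \<Omega>) (\<lambda>z. ereal (zs \<bullet> (z - zbar) / norm (z - zbar))) \<le> 0}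
     else {})"

definition limiting_normal_cone :: "'a::real_inner \<Rightarrow> 'a set \<Rightarrow> 'a set" where
  "limiting_normal_cone zbar \<Omega> =
    {zs. \<exists>z w. z \<longlonglongrightarrow> zbar \<and> w \<longlonglongrightarrow> zs \<and> (\<forall>k::nat. w k \<in> regular_normal_cone (z k) \<Omega>)}"

definition regular_coderivative ::
  "('a::real_inner \<Rightarrow> 'b::real_inner set) \<Rightarrow> 'a \<Rightarrow> 'b \<Rightarrow> 'b \<Rightarrow> 'a set" where
  "regular_coderivative G x y ys = {xs. (xs, - ys) \<in> regular_normal_cone (x, y) (gph G)}"

definition limiting_coderivative ::
  "('a::real_inner \<Rightarrow> 'b::real_inner set) \<Rightarrow> 'a \<Rightarrow> 'b \<Rightarrow> 'b \<Rightarrow> 'a set" where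
  "limiting_coderivative G x y ys = {xs. (xs, - ys) \<in> limiting_normal_cone (x, y) (gph G)}"


section \<open>Derivatives\<close>

definition gradient :: "('a::real_inner \<Rightarrow> real) \<Rightarrow> 'a \<Rightarrow> 'a" where
  "gradient f x = (THE D. GDERIV f x :> D)"

text \<open>Meant for open \<open>S\<close>; \<open>f'\<close> is continuous with respect to the operator norm.\<close>

definition C1_on :: "('a::real_normed_vector \<Rightarrow> 'b::real_normed_vector) \<Rightarrow> 'a set \<Rightarrow> bool" where
  "C1_on f S \<longleftrightarrow>
    (\<exists>f' :: 'a \<Rightarrow> 'a \<Rightarrow>\<^sub>L 'b. continuous_on S f' \<and>
       (\<forall>x\<in>S. (f has_derivative blinfun_apply (f' x)) (at x)))"

definition C1_around :: "('a::real_normed_vector \<Rightarrow> 'b::real_normed_vector) \<Rightarrow> 'a \<Rightarrow> bool" where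
  "C1_around f x \<longleftrightarrow> (\<exists>W. open W \<and> x \<in> W \<and> C1_on f W)"


section \<open>Normal integrands\<close>

definition set_valued_normal_integrand ::
  "'t measure \<Rightarrow> ('t \<Rightarrow> 'a::topological_space \<Rightarrow> 'b::topological_space set) \<Rightarrow> bool" where
  "set_valued_normal_integrand M \<Phi> \<longleftrightarrow>
    (\<forall>t\<in>space M. closed (gph (\<Phi> t))) \<and>
    {(t, x, y). t \<in> space M \<and> y \<in> \<Phi> t x} \<in> sets (M \<Otimes>\<^sub>M borel)"

definition lower_semicont :: "('a::topological_space \<Rightarrow> real) \<Rightarrow> bool" where
  "lower_semicont f \<longleftrightarrow> (\<forall>x. ereal (f x) \<le> Liminf (at x) (\<lambda>v. ereal (f v)))"

definition convex_normal_integrand ::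
  "'t measure \<Rightarrow> ('t \<Rightarrow> 'a::real_normed_vector \<Rightarrow> real) \<Rightarrow> bool" where
  "convex_normal_integrand M f \<longleftrightarrow>
    (\<lambda>(t, v). f t v) \<in> borel_measurable (M \<Otimes>\<^sub>M borel) \<and>
    (\<forall>t\<in>space M. lower_semicont (f t) \<and> convex_on UNIV (f t))"


section \<open>Aumann integrals and expected-integral maps\<close>

definition aumann_integral ::
  "'t measure \<Rightarrow> ('t \<Rightarrow> 'a::{banach, second_countable_topology} set) \<Rightarrow> 'a set" where
  "aumann_integral M A =
    {integral\<^sup>L M v | v. integrable M v \<and> (AE t in M. v t \<in> A t)}"

definition expected_map ::
  "'t measure \<Rightarrow> ('t \<Rightarrow> 'a \<Rightarrow> 'b::{banach, second_countable_topology} set) \<Rightarrow> 'a \<Rightarrow> 'b set" where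
  "expected_map M \<Phi> x = aumann_integral M (\<lambda>t. \<Phi> t x)"

text \<open>Elements of \<open>L\<^sup>1\<close> are represented by integrable functions rather than by classes.\<close>

definition selections ::
  "'t measure \<Rightarrow> ('t \<Rightarrow> 'a \<Rightarrow> 'b::{banach, second_countable_topology} set) \<Rightarrow> 'a \<Rightarrow> 'b
    \<Rightarrow> ('t \<Rightarrow> 'b) set" where
  "selections M \<Phi> x y =
    {v. integrable M v \<and> integral\<^sup>L M v = y \<and> (AE t in M. v t \<in> \<Phi> t x)}"

definition selections_inner_semicompact ::
  "'t measure \<Rightarrow>
    ('t \<Rightarrow> 'a::topological_space \<Rightarrow> 'b::{banach, second_countable_topology} set) \<Rightarrow>
    'a \<Rightarrow> 'b \<Rightarrow> bool" where
  "selections_inner_semicompact M \<Phi> xbar ybar \<longleftrightarrow>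
    (\<forall>x y. x \<longlonglongrightarrow> xbar \<and> y \<longlonglongrightarrow> ybar \<and> (\<forall>k::nat. selections M \<Phi> (x k) (y k) \<noteq> {}) \<longrightarrow>
      (\<exists>v. (\<forall>k. v k \<in> selections M \<Phi> (x k) (y k)) \<and>
        (\<exists>r w. strict_mono r \<and> integrable M w \<and>
          (\<lambda>j. \<integral>t. norm (v (r j) t - w t) \<partial>M) \<longlonglongrightarrow> 0)))"


section \<open>Inequality systems and qualification conditions\<close>

definition sublevel_map ::
  "'i set \<Rightarrow> ('i \<Rightarrow> 't \<Rightarrow> 'z \<times> 'y \<Rightarrow> real) \<Rightarrow> 't \<Rightarrow> 'z \<Rightarrow> 'y set" where
  "sublevel_map I \<phi> t z = {y. \<forall>i\<in>I. \<phi> i t (z, y) \<le> 0}"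

definition active_indices ::
  "'i set \<Rightarrow> ('i \<Rightarrow> 't \<Rightarrow> 'z \<times> 'y \<Rightarrow> real) \<Rightarrow> ('t \<Rightarrow> 'x \<Rightarrow> 'z) \<Rightarrow> 't \<Rightarrow> 'x \<Rightarrow> 'y \<Rightarrow> 'i set" where
  "active_indices I \<phi> g t x y = {i \<in> I. \<phi> i t (g t x, y) = 0}"

definition integrable_slater ::
  "'t measure \<Rightarrow> 'i set \<Rightarrow>
    ('i \<Rightarrow> 't \<Rightarrow> 'z::real_normed_vector \<times> 'y::{banach, second_countable_topology} \<Rightarrow> real) \<Rightarrow>
    ('t \<Rightarrow> 'z) \<Rightarrow> bool" where
  "integrable_slater M I \<phi> z \<longleftrightarrow>
    (\<exists>\<eta>>0. \<forall>h\<in>cball 0 \<eta>. \<exists>y. integrable M y \<and>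
      (AE t in M. \<forall>i\<in>I. \<phi> i t (z t + h, y t) < 0))"

definition ITQC ::
  "'t measure \<Rightarrow> 'i set \<Rightarrow> ('i \<Rightarrow> 't \<Rightarrow> (real^'q) \<times> (real^'m) \<Rightarrow> real) \<Rightarrow>
    ('t \<Rightarrow> real^'n \<Rightarrow> real^'q) \<Rightarrow> real^'n \<Rightarrow> bool" where
  "ITQC M I \<phi> g xbar \<longleftrightarrow>
    (\<exists>\<eta>>0. \<forall>x\<in>cball xbar \<eta>. AE t in M. \<forall>y \<in> sublevel_map I \<phi> t (g t x). \<forall>zs c.
      (zs, 0) = (\<Sum>i\<in>active_indices I \<phi> g t x y. c i *\<^sub>R gradient (\<phi> i t) (g t x, y)) \<and>
      (\<forall>i\<in>active_indices I \<phi> g t x y. c i \<ge> 0) \<and>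
      transpose (jacobian (g t) (at x)) *v zs = 0
      \<longrightarrow> zs = 0)"

end

theory Submission
  imports Defs
begin

text \<open>
  The graph of \<open>F\<^sub>t\<close> is convex, so its normals \<open>(z\<^sup>*, -y\<^sup>*)\<close> are described by linear inequalities.
  Testing a regular normal \<open>(x\<^sup>*, -y\<^sup>*)\<close> of the graph of \<open>E\<^sub>\<Phi>\<close> along \<open>x + s u\<close> yields the key inequality
  \<open>\<langle>x\<^sup>*, u\<rangle> \<le> \<langle>y\<^sup>*, \<integral> v\<rangle>\<close> for all integrable \<open>v\<close> with
  \<open>(g\<^sub>t(x) + \<nabla>g\<^sub>t(x) u, y(t) + v(t))\<close> in the graph of \<open>F\<^sub>t\<close>: the error of linearizing \<open>g\<^sub>t\<close> is absorbed
  by a convex combination with a Slater selection, of weight proportional to that error.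
  Hahn--Banach, applied on bounded measurable functions \<open>w\<close> to the value function
  \<open>inf \<langle>y\<^sup>*, \<integral> v\<rangle>\<close> over \<open>(w, v)\<close> tangent to the graphs, turns the key inequality into a linear
  functional; the Slater selections dominate it by a weighted \<open>L\<^sup>1\<close> norm, so Radon--Nikodym
  represents it by an integrable \<open>z\<^sup>*(t)\<close>, which is the required multiplier.
  Limiting coderivatives reduce to the same argument because the key inequality itself passes to the
  limit along the sequences supplied by inner semicompactness.
\<close>

text \<open>No measurable selection theorem is invoked. The Slater condition supplies one integrable
  selection for each constant shift, with a null set depending on the shift. Only the finitely many
  shifts along the coordinate axes are used: convex combinations with measurable weights turn them
  into selections for every small measurable shift, all bounded by one integrable function
  \<open>K\<close>. This bound is what the rest rests on. It dominates the corrections of the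
  linearization error, keeps the value function finite, and excludes functionals on bounded
  functions that are only finitely additive.

  Duality is carried out for integrals, so pointwise normals appear only at the end: the functional
  is tested with indicators times fixed vectors \<open>p\<close>, a countable dense set of
  \<open>p\<close> costs one null set, and nonempty interior extends the inequality to the whole
  convex set.

  Limits are taken in the key inequality and not in the multipliers, so no compactness of a sequence
  of multipliers has to be argued. The selections enter that limit through their integrals and
  through feasibility of the limit selection.\<close>

section \<open>Normal cones and convex inequality systems\<close>

text \<open>Regular normals are polar to the contingent cone: the upper limit gives
  \<open>zs \<bullet> d k \<le> e * norm (d k)\<close> eventually, and both sides converge. The
  direction may vary with \<open>k\<close>, which later leaves room for vanishing corrections of the
  integrals.\<close>

lemma regular_normal_cone_sequential:
  assumes "zs \<in> regular_normal_cone z \<Omega>"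
    and s: "\<And>k. s k > 0" "s \<longlonglongrightarrow> 0" and d: "d \<longlonglongrightarrow> d0"
    and mem: "\<And>k. z + s k *\<^sub>R d k \<in> \<Omega>"
  shows "zs \<bullet> d0 \<le> 0"
proof (cases "d0 = 0")
  case False
  have lim: "Limsup (at z within \<Omega>) (\<lambda>z'. ereal (zs \<bullet> (z' - z) / norm (z' - z))) \<le> 0"
    using assms(1) by (auto simp: regular_normal_cone_def split: if_splits)
  have tends: "(\<lambda>k. z + s k *\<^sub>R d k) \<longlonglongrightarrow> z"
    using tendsto_add[OF tendsto_const tendsto_scaleR[OF s(2) d], of z] by simp
  \<comment> \<open>The filter in the cone omits the base point, so the sequence has to leave it; a
    nonzero limit direction guarantees this.\<close>
  have ev: "\<forall>\<^sub>F k in sequentially. d k \<noteq> 0"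
    using tendsto_imp_eventually_ne[OF d False] .
  have filt: "filterlim (\<lambda>k. z + s k *\<^sub>R d k) (at z within \<Omega>) sequentially"
    unfolding filterlim_at using tends ev mem s(1)
    by (auto elim!: eventually_mono simp: less_imp_neq[symmetric] dest: less_imp_neq)
  have "zs \<bullet> d0 \<le> e * norm d0" if "e > 0" for e
  proof -
    have "Limsup (at z within \<Omega>) (\<lambda>z'. ereal (zs \<bullet> (z' - z) / norm (z' - z))) < ereal e"
      using lim that by (metis ereal_less(2) order_le_less_trans)
    from Limsup_lessD[OF this]
    have "\<forall>\<^sub>F z' in at z within \<Omega>. zs \<bullet> (z' - z) / norm (z' - z) < e" by simp
    with filt have "\<forall>\<^sub>F k in sequentially.
        zs \<bullet> (z + s k *\<^sub>R d k - z) / norm (z + s k *\<^sub>R d k - z) < e"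
      unfolding filterlim_iff by blast
    with ev have "\<forall>\<^sub>F k in sequentially. zs \<bullet> d k \<le> e * norm (d k)"
    proof eventually_elim
      case (elim k)
      then show ?case using s(1)[of k]
        by (simp add: divide_simps abs_if split: if_splits)
    qed
    moreover have "(\<lambda>k. zs \<bullet> d k) \<longlonglongrightarrow> zs \<bullet> d0" "(\<lambda>k. e * norm (d k)) \<longlonglongrightarrow> e * norm d0"
      by (intro tendsto_intros d)+
    ultimately show ?thesis by (intro tendsto_le[OF trivial_limit_sequentially])
  qed
  then have "zs \<bullet> d0 / norm d0 \<le> 0 + e" if "e > 0" for e
    using that False by (simp add: divide_simps)
  then have "zs \<bullet> d0 / norm d0 \<le> 0" by (rule field_le_epsilon)
  then show ?thesis using False by (simp add: divide_simps split: if_splits)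
qed simp

section \<open>Normal cones of convex sets\<close>

lemma regular_normal_coneI:
  assumes "z \<in> \<Omega>" "\<And>q. q \<in> \<Omega> \<Longrightarrow> zs \<bullet> (q - z) \<le> 0"
  shows "zs \<in> regular_normal_cone z \<Omega>"
proof -
  have "\<forall>\<^sub>F q in at z within \<Omega>. ereal (zs \<bullet> (q - z) / norm (q - z)) \<le> 0"
    using assms(2) by (auto simp: eventually_at_filter divide_nonpos_nonneg)
  then show ?thesis
    using assms(1) by (auto simp: regular_normal_cone_def intro: Limsup_bounded)
qed

lemma regular_normal_cone_subset_limiting:
  "regular_normal_cone z \<Omega> \<subseteq> limiting_normal_cone z \<Omega>"
  unfolding limiting_normal_cone_def by (force intro: exI[of _ "\<lambda>_. z"])

lemma regular_normal_cone_convexD: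
  assumes "convex \<Omega>" "zs \<in> regular_normal_cone z \<Omega>" "q \<in> \<Omega>"
  shows "zs \<bullet> (q - z) \<le> 0"
proof (rule regular_normal_cone_sequential[OF assms(2)])
  show "(\<lambda>k. inverse (real (Suc k))) \<longlonglongrightarrow> 0" by (rule LIMSEQ_inverse_real_of_nat)
  have z: "z \<in> \<Omega>" using assms(2) by (auto simp: regular_normal_cone_def split: if_splits)
  fix k
  show "z + inverse (real (Suc k)) *\<^sub>R (q - z) \<in> \<Omega>"
    using convexD_alt[OF assms(1) z assms(3), of "inverse (real (Suc k))"]
    by (simp add: algebra_simps inverse_le_1_iff)
qed auto

text \<open>On a convex set a regular normal satisfies its inequality against every point, not only
  nearby ones. Such a global inequality is preserved when base points and normals converge.\<close>

lemma limiting_normal_cone_convex: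
  assumes "convex \<Omega>" "z \<in> \<Omega>"
  shows "limiting_normal_cone z \<Omega> = {zs. \<forall>q\<in>\<Omega>. zs \<bullet> (q - z) \<le> 0}"
proof safe
  fix zs q assume "zs \<in> limiting_normal_cone z \<Omega>" and q: "q \<in> \<Omega>"
  then obtain zk w where *: "zk \<longlonglongrightarrow> z" "w \<longlonglongrightarrow> zs" "\<And>k. w k \<in> regular_normal_cone (zk k) \<Omega>"
    by (auto simp: limiting_normal_cone_def)
  have "(\<lambda>k. w k \<bullet> (q - zk k)) \<longlonglongrightarrow> zs \<bullet> (q - z)" by (intro tendsto_intros *)
  moreover have "w k \<bullet> (q - zk k) \<le> 0" for k
    by (rule regular_normal_cone_convexD[OF assms(1) *(3) q])
  ultimately show "zs \<bullet> (q - z) \<le> 0" by (intro LIMSEQ_le_const2) auto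
next
  fix zs assume "\<forall>q\<in>\<Omega>. zs \<bullet> (q - z) \<le> 0"
  then show "zs \<in> limiting_normal_cone z \<Omega>"
    using regular_normal_coneI[OF assms(2)] regular_normal_cone_subset_limiting by blast
qed

section \<open>Gradients and normals of convex inequality systems\<close>

lemma C1_around_gradient:
  fixes f :: "'a::euclidean_space \<Rightarrow> real"
  assumes "C1_around f x"
  shows "(f has_derivative (\<lambda>h. h \<bullet> gradient f x)) (at x)"
proof -
  obtain f' where f': "(f has_derivative blinfun_apply f') (at x)"
    using assms unfolding C1_around_def C1_on_def by blast
  \<comment> \<open>The Riesz vector of the derivative. Its existence and uniqueness give the
    \<open>THE\<close> in \<open>gradient\<close> a meaning.\<close>
  define D where "D = (\<Sum>b\<in>Basis. f' b *\<^sub>R b)"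
  have "f' h = h \<bullet> D" for h
  proof -
    have "f' h = f' (\<Sum>b\<in>Basis. (h \<bullet> b) *\<^sub>R b)" by (simp add: euclidean_representation)
    also have "\<dots> = h \<bullet> D"
      by (simp add: D_def blinfun.sum_right blinfun.scaleR_right inner_sum_right mult.commute)
    finally show ?thesis .
  qed
  then have "blinfun_apply f' = (\<lambda>h. h \<bullet> D)" by blast
  then have D: "GDERIV f x :> D" using f' by (simp add: gderiv_def)
  moreover have "D' = D" if "GDERIV f x :> D'" for D'
    using has_derivative_unique[OF that[unfolded gderiv_def] D[unfolded gderiv_def]]
    by (metis vector_eq_ldot)
  ultimately have "gradient f x = D" unfolding gradient_def by (rule the_equality)
  with D show ?thesis by (simp add: gderiv_def)
qed

text \<open>Convexity bounds each forward difference quotient on the segment from \<open>p\<close>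
  to \<open>q\<close> by \<open>f q - f p\<close>, and the derivative is the limit of these
  quotients.\<close>

lemma convex_gradient_le:
  fixes f :: "'a::real_inner \<Rightarrow> real"
  assumes conv: "convex_on UNIV f" and D: "(f has_derivative (\<lambda>h. h \<bullet> D)) (at p)"
  shows "(q - p) \<bullet> D \<le> f q - f p"
proof -
  define h where "h s = f (p + s *\<^sub>R (q - p))" for s :: real
  have "((\<lambda>s::real. p + s *\<^sub>R (q - p)) has_derivative (\<lambda>s. s *\<^sub>R (q - p))) (at 0)"
    by (auto intro!: derivative_eq_intros)
  from has_derivative_compose[OF this, of f "\<lambda>h. h \<bullet> D"] D
  have "(h has_real_derivative ((q - p) \<bullet> D)) (at 0)"
    by (simp add: h_def[abs_def] has_field_derivative_def mult.commute[of _ "_ \<bullet> _"]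
        inner_scaleR_left mult_commute_abs)
  then have "((\<lambda>s. (h s - h 0) / s) \<longlongrightarrow> (q - p) \<bullet> D) (at_right 0)"
    by (auto simp: has_field_derivative_iff intro: tendsto_within_subset)
  moreover have "\<forall>\<^sub>F s in at_right 0. (h s - h 0) / s \<le> f q - f p"
  proof -
    have "(h s - h 0) / s \<le> f q - f p" if "0 < s" "s < 1" for s
    proof -
      have "h s \<le> (1 - s) * f p + s * f q"
        using convex_onD[OF conv, of s p q] that by (simp add: h_def algebra_simps)
      then show ?thesis using that by (simp add: h_def divide_simps algebra_simps)
    qed
    then show ?thesis
      unfolding eventually_at_right_field by (intro exI[of _ 1]) auto
  qed
  ultimately show ?thesis by (intro tendsto_upperbound) auto
qed

text \<open>The forward direction is a Farkas argument. The cone of the active gradients is finitely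
  generated, hence closed, so a normal \<open>n\<close> outside it is separated by some
  \<open>a\<close>. The direction \<open>- a\<close> does not increase the active constraints to
  first order, yet has positive product with \<open>n\<close>. A slight tilt toward the Slater point
  makes the decrease strict, so a short step is feasible and contradicts normality.\<close>

lemma normals_inequality_system:
  fixes f :: "'i \<Rightarrow> 'a::euclidean_space \<Rightarrow> real"
  assumes I: "finite I" and conv: "\<And>i. i \<in> I \<Longrightarrow> convex_on UNIV (f i)"
    and p: "\<And>i. i \<in> I \<Longrightarrow> f i p \<le> 0" and slater: "\<And>i. i \<in> I \<Longrightarrow> f i p0 < 0"
    and D: "\<And>i. i \<in> I \<Longrightarrow> (f i has_derivative (\<lambda>h. h \<bullet> D i)) (at p)"
  shows "(\<forall>q. (\<forall>i\<in>I. f i q \<le> 0) \<longrightarrow> n \<bullet> (q - p) \<le> 0) \<longleftrightarrow>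
    (\<exists>c. (\<forall>i\<in>{i\<in>I. f i p = 0}. c i \<ge> 0) \<and> n = (\<Sum>i\<in>{i\<in>I. f i p = 0}. c i *\<^sub>R D i))"
    (is "?L \<longleftrightarrow> ?R")
proof
  define J where "J = {i\<in>I. f i p = 0}"
  have J: "finite J" "J \<subseteq> I" using I by (auto simp: J_def)
  assume ?R
  then obtain c where c: "\<forall>i\<in>J. c i \<ge> 0" "n = (\<Sum>i\<in>J. c i *\<^sub>R D i)" by (auto simp: J_def)
  show ?L
  proof (intro allI impI)
    fix q assume q: "\<forall>i\<in>I. f i q \<le> 0"
    have "c i * (D i \<bullet> (q - p)) \<le> 0" if "i \<in> J" for i
    proof -
      have "(q - p) \<bullet> D i \<le> 0"
        using convex_gradient_le[OF conv D, of i q] q that J by (auto simp: J_def)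
      then show ?thesis using c(1) that by (auto simp: inner_commute mult_nonneg_nonpos)
    qed
    then show "n \<bullet> (q - p) \<le> 0"
      unfolding c(2) by (simp add: inner_sum_left sum_nonpos)
  qed
next
  define J where "J = {i\<in>I. f i p = 0}"
  have J: "finite J" "J \<subseteq> I" using I by (auto simp: J_def)
  define K where "K = {(\<Sum>i\<in>J. c i *\<^sub>R D i) | c. \<forall>i\<in>J. c i \<ge> 0}"
  assume L: ?L
  have "convex_cone K"
    unfolding convex_cone_iff
  proof (intro conjI ballI allI impI)
    show "0 \<in> K" by (auto simp: K_def intro!: exI[of _ "\<lambda>_. 0"])
  next
    fix x y assume "x \<in> K" "y \<in> K"
    then obtain c d where "x = (\<Sum>i\<in>J. c i *\<^sub>R D i)" "y = (\<Sum>i\<in>J. d i *\<^sub>R D i)"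
      "\<forall>i\<in>J. c i \<ge> 0" "\<forall>i\<in>J. d i \<ge> 0" by (auto simp: K_def)
    then show "x + y \<in> K"
      by (auto simp: K_def scaleR_add_left sum.distrib intro!: exI[of _ "\<lambda>i. c i + d i"])
  next
    fix x and a :: real assume "x \<in> K" "0 \<le> a"
    then obtain c where "x = (\<Sum>i\<in>J. c i *\<^sub>R D i)" "\<forall>i\<in>J. c i \<ge> 0" by (auto simp: K_def)
    then show "a *\<^sub>R x \<in> K" using \<open>0 \<le> a\<close>
      by (auto simp: K_def scaleR_sum_right intro!: exI[of _ "\<lambda>i. a * c i"])
  qed
  moreover have "D ` J \<subseteq> K"
  proof
    fix x assume "x \<in> D ` J"
    then obtain j where "j \<in> J" "x = D j" by blast
    then show "x \<in> K" using J(1)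
      by (auto simp: K_def if_distrib[of "\<lambda>r. r *\<^sub>R _"] sum.delta cong: if_cong
          intro!: exI[of _ "\<lambda>i. if i = j then 1 else 0"])
  qed
  ultimately have sub: "convex_cone hull (D ` J) \<subseteq> K" by (intro hull_minimal)
  have "n \<in> convex_cone hull (D ` J)"
  proof (rule ccontr)
    let ?C = "convex_cone hull (D ` J)"
    assume "n \<notin> ?C"
    then obtain a b where ab: "a \<bullet> n < b" "\<And>x. x \<in> ?C \<Longrightarrow> a \<bullet> x > b"
      using separating_hyperplane_closed_point[of ?C n] closed_convex_cone_hull[of "D ` J"] J(1)
        convex_convex_cone_hull[of "D ` J"] by auto
    have b: "b < 0" using ab(2)[OF convex_cone_hull_contains_0] by simp
    have pos: "a \<bullet> D i \<ge> 0" if "i \<in> J" for i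
    proof (rule ccontr)
      assume neg: "\<not> a \<bullet> D i \<ge> 0"
      have "D i \<in> ?C" using that by (auto intro: hull_inc)
      \<comment> \<open>The factor makes the value under \<open>a\<close> exactly \<open>b\<close>,
        against the strict separation.\<close>
      then have "(b / (a \<bullet> D i)) *\<^sub>R D i \<in> ?C"
        using b neg by (intro convex_cone_hull_mul) (auto simp: divide_nonpos_nonpos)
      from ab(2)[OF this] show False using neg by simp
    qed
    have "((\<lambda>e. n \<bullet> (e *\<^sub>R (p0 - p) - a)) \<longlongrightarrow> n \<bullet> (0 *\<^sub>R (p0 - p) - a)) (at_right (0::real))"
      by (intro tendsto_intros)
    moreover have "n \<bullet> (0 *\<^sub>R (p0 - p) - a) > 0" using ab(1) b by (simp add: inner_commute)
    ultimately have "\<forall>\<^sub>F e in at_right (0::real). n \<bullet> (e *\<^sub>R (p0 - p) - a) > 0"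
      by (rule order_tendstoD)
    then have "\<forall>\<^sub>F e in at_right (0::real). e > 0 \<and> n \<bullet> (e *\<^sub>R (p0 - p) - a) > 0"
      using eventually_at_right_less[of 0] by eventually_elim simp
    then obtain e :: real where e: "e > 0" "n \<bullet> (e *\<^sub>R (p0 - p) - a) > 0"
      using eventually_happens by force
    define d where "d = e *\<^sub>R (p0 - p) - a"
    have dneg: "d \<bullet> D i < 0" if "i \<in> J" for i
    proof -
      have "(p0 - p) \<bullet> D i < 0"
        using convex_gradient_le[OF conv D, of i p0] slater[of i] that J by (auto simp: J_def)
      then have "e * ((p0 - p) \<bullet> D i) < 0" using e(1) by (simp add: mult_pos_neg)
      then show ?thesis using pos[OF that] unfolding d_def inner_diff_left inner_scaleR_left by linarith
    qed
    have "\<forall>\<^sub>F s in at_right (0::real). f i (p + s *\<^sub>R d) \<le> 0" if i: "i \<in> I" for i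
    proof (cases "i \<in> J")
      case True
      have "((\<lambda>s::real. p + s *\<^sub>R d) has_derivative (\<lambda>s. s *\<^sub>R d)) (at 0)"
        by (auto intro!: derivative_eq_intros)
      from has_derivative_compose[OF this, of "f i" "\<lambda>h. h \<bullet> D i"] D[OF i]
      have "((\<lambda>s. f i (p + s *\<^sub>R d)) has_real_derivative (d \<bullet> D i)) (at 0)"
        by (simp add: has_field_derivative_def inner_scaleR_left mult_commute_abs)
      from DERIV_neg_dec_right[OF this dneg[OF True]]
      obtain \<delta> where "\<delta> > 0" "\<And>h. 0 < h \<Longrightarrow> h < \<delta> \<Longrightarrow> f i (p + h *\<^sub>R d) < f i p" by auto
      then show ?thesis using True
        by (auto simp: eventually_at_right J_def intro!: exI[of _ \<delta>] less_imp_le)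
    next
      case False
      have "f i p < 0" using False p[OF i] i by (auto simp: J_def less_le)
      moreover have "isCont (f i) p" using D[OF i] by (rule has_derivative_continuous)
      then have "((\<lambda>s. f i (p + s *\<^sub>R d)) \<longlongrightarrow> f i p) (at_right (0::real))"
        by (rule isCont_tendsto_compose) (auto intro!: tendsto_eq_intros)
      ultimately have "\<forall>\<^sub>F s in at_right (0::real). f i (p + s *\<^sub>R d) < 0"
        by (intro order_tendstoD)
      then show ?thesis by eventually_elim simp
    qed
    then have "\<forall>\<^sub>F s in at_right (0::real). \<forall>i\<in>I. f i (p + s *\<^sub>R d) \<le> 0"
      using I by (simp add: eventually_ball_finite)
    then have "\<forall>\<^sub>F s in at_right (0::real). s > 0 \<and> (\<forall>i\<in>I. f i (p + s *\<^sub>R d) \<le> 0)"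
      using eventually_at_right_less[of 0] by eventually_elim simp
    then obtain s :: real where s: "s > 0" "\<forall>i\<in>I. f i (p + s *\<^sub>R d) \<le> 0"
      using eventually_happens by force
    with L have "n \<bullet> (p + s *\<^sub>R d - p) \<le> 0" by blast
    then show False using s(1) e(2) by (simp add: d_def[symmetric] mult_le_0_iff)
  qed
  with sub show ?R by (auto simp: K_def J_def)
qed

section \<open>A Hahn--Banach theorem for cones of functions\<close>

text \<open>A pair \<open>(w, r)\<close> records an upper value \<open>r\<close> of a sublinear
  function at \<open>w\<close>. With this epigraph-like cone nothing has to be known about
  finiteness or attainment of infima beforehand.\<close>

definition pointwise_cone :: "(('t \<Rightarrow> 'b::real_vector) \<times> real) set \<Rightarrow> bool" where
  "pointwise_cone Q \<longleftrightarrow> ((\<lambda>_. 0), 0) \<in> Q \<and>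
    (\<forall>w r w' r'. (w, r) \<in> Q \<longrightarrow> (w', r') \<in> Q \<longrightarrow> (\<lambda>t. w t + w' t, r + r') \<in> Q) \<and>
    (\<forall>w r c. (w, r) \<in> Q \<longrightarrow> c > 0 \<longrightarrow> (\<lambda>t. c *\<^sub>R w t, c * r) \<in> Q)"

lemma pointwise_coneD:
  assumes "pointwise_cone Q"
  shows "((\<lambda>_. 0), 0) \<in> Q"
    and "(w, r) \<in> Q \<Longrightarrow> (w', r') \<in> Q \<Longrightarrow> (\<lambda>t. w t + w' t, r + r') \<in> Q"
    and "(w, r) \<in> Q \<Longrightarrow> c \<ge> 0 \<Longrightarrow> (\<lambda>t. c *\<^sub>R w t, c * r) \<in> Q"
proof -
  show "((\<lambda>_. 0), 0) \<in> Q" "(w, r) \<in> Q \<Longrightarrow> (w', r') \<in> Q \<Longrightarrow> (\<lambda>t. w t + w' t, r + r') \<in> Q"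
    using assms by (auto simp: pointwise_cone_def)
  show "(w, r) \<in> Q \<Longrightarrow> c \<ge> 0 \<Longrightarrow> (\<lambda>t. c *\<^sub>R w t, c * r) \<in> Q"
    using assms by (cases "c = 0") (auto simp: pointwise_cone_def)
qed

text \<open>Nonnegativity above the zero function excludes the value minus infinity. It is the
  property that survives unions of chains in Zorn's lemma.\<close>

definition proper_cone :: "(('t \<Rightarrow> 'b::real_vector) \<times> real) set \<Rightarrow> bool" where
  "proper_cone Q \<longleftrightarrow> pointwise_cone Q \<and> (\<forall>r. ((\<lambda>_. 0), r) \<in> Q \<longrightarrow> r \<ge> 0)"

text \<open>The extension step of Hahn-Banach: adjoin the ray through \<open>(w, \<rho>)\<close>. A
  new element above zero comes from some \<open>v = - c w\<close>; after division by
  \<open>c\<close>, the bound on the values at \<open>- w\<close> makes its second component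
  nonnegative. Maximality then forbids a proper enlargement.\<close>

lemma maximal_proper_cone_mem:
  assumes K: "proper_cone K" and max: "\<And>K'. proper_cone K' \<Longrightarrow> K \<subseteq> K' \<Longrightarrow> K' = K"
    and r: "\<And>r. ((\<lambda>t. - w t), r) \<in> K \<Longrightarrow> r \<ge> - \<rho>"
  shows "(w, \<rho>) \<in> K"
proof -
  note cone = pointwise_coneD[of K]
  have cK: "pointwise_cone K" using K by (simp add: proper_cone_def)
  define K' where "K' = {(\<lambda>t. v t + c *\<^sub>R w t, s + c * \<rho>) | v s c. (v, s) \<in> K \<and> c \<ge> 0}"
  have "pointwise_cone K'"
    unfolding pointwise_cone_def
  proof (intro conjI allI impI)
    show "((\<lambda>_. 0), 0) \<in> K'" unfolding K'_def
      using cone(1)[OF cK] by (auto intro!: exI[of _ "\<lambda>_. 0"] exI[of _ 0])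
  next
    fix v1 s1 v2 s2 assume "(v1, s1) \<in> K'" "(v2, s2) \<in> K'"
    then obtain v s c v' s' c' where
      *: "(v, s) \<in> K" "c \<ge> 0" "v1 = (\<lambda>t. v t + c *\<^sub>R w t)" "s1 = s + c * \<rho>"
      "(v', s') \<in> K" "c' \<ge> 0" "v2 = (\<lambda>t. v' t + c' *\<^sub>R w t)" "s2 = s' + c' * \<rho>"
      unfolding K'_def by auto
    show "(\<lambda>t. v1 t + v2 t, s1 + s2) \<in> K'"
      unfolding K'_def mem_Collect_eq
      by (rule exI[of _ "\<lambda>t. v t + v' t"], rule exI[of _ "s + s'"], rule exI[of _ "c + c'"])
        (use * cone(2)[OF cK] in \<open>auto simp: algebra_simps\<close>)
  next
    fix v1 s1 and d :: real assume "(v1, s1) \<in> K'" "d > 0"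
    then obtain v s c where
      *: "(v, s) \<in> K" "c \<ge> 0" "v1 = (\<lambda>t. v t + c *\<^sub>R w t)" "s1 = s + c * \<rho>"
      unfolding K'_def by auto
    show "(\<lambda>t. d *\<^sub>R v1 t, d * s1) \<in> K'"
      unfolding K'_def mem_Collect_eq
      by (rule exI[of _ "\<lambda>t. d *\<^sub>R v t"], rule exI[of _ "d * s"], rule exI[of _ "d * c"])
        (use * cone(3)[OF cK *(1), of d] \<open>d > 0\<close> in \<open>auto simp: algebra_simps\<close>)
  qed
  moreover have "s \<ge> 0" if "((\<lambda>_. 0), s) \<in> K'" for s
  proof -
    from that obtain v s' c where
      *: "(v, s') \<in> K" "c \<ge> 0" "(\<lambda>_. 0) = (\<lambda>t. v t + c *\<^sub>R w t)" "s = s' + c * \<rho>"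
      unfolding K'_def by auto
    have v: "v t = - (c *\<^sub>R w t)" for t
      using fun_cong[OF *(3), of t] by (simp add: eq_neg_iff_add_eq_0)
    show "s \<ge> 0"
    proof (cases "c = 0")
      case True
      then have "v = (\<lambda>_. 0)" using v by auto
      then show ?thesis using * True K by (auto simp: proper_cone_def)
    next
      case False
      then have "c > 0" using * by simp
      then have "(\<lambda>t. inverse c *\<^sub>R v t, inverse c * s') \<in> K" using cone(3)[OF cK *(1)] by simp
      then have "inverse c * s' \<ge> - \<rho>" using \<open>c > 0\<close> by (intro r) (simp add: v)
      then show ?thesis using \<open>c > 0\<close> *(4) by (simp add: field_simps)
    qed
  qed
  ultimately have "proper_cone K'" by (simp add: proper_cone_def)
  moreover have "K \<subseteq> K'"
  proof (safe)
    fix v s assume "(v, s) \<in> K"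
    then show "(v, s) \<in> K'" unfolding K'_def mem_Collect_eq
      by (intro exI[of _ v] exI[of _ s] exI[of _ 0]) auto
  qed
  ultimately have "K' = K" by (rule max)
  moreover have "(w, \<rho>) \<in> K'" unfolding K'_def mem_Collect_eq
    using cone(1)[OF cK] by (intro exI[of _ "\<lambda>_. 0"] exI[of _ 0] exI[of _ 1]) auto
  ultimately show ?thesis by simp
qed

text \<open>In a maximal proper cone each \<open>w\<close> in \<open>V\<close> has a value
  \<open>\<rho>\<close> with both \<open>(w, \<rho>)\<close> and its negative in the cone.
  Properness makes this two-sided value unique and a lower bound of all values at \<open>w\<close>,
  so the cone operations turn it into a linear functional on \<open>V\<close>.\<close>

lemma linear_minorant_of_cone:
  fixes Q :: "(('t \<Rightarrow> 'b::real_vector) \<times> real) set"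
  assumes Q: "proper_cone Q"
    and V: "\<And>w. w \<in> V \<Longrightarrow> \<exists>r. (w, r) \<in> Q" "\<And>w. w \<in> V \<Longrightarrow> (\<lambda>t. - w t) \<in> V"
  obtains l where "\<And>w r. w \<in> V \<Longrightarrow> (w, r) \<in> Q \<Longrightarrow> l w \<le> r"
    and "\<And>w w'. w \<in> V \<Longrightarrow> w' \<in> V \<Longrightarrow> (\<lambda>t. w t + w' t) \<in> V \<Longrightarrow> l (\<lambda>t. w t + w' t) = l w + l w'"
    and "\<And>w c. w \<in> V \<Longrightarrow> c > 0 \<Longrightarrow> (\<lambda>t. c *\<^sub>R w t) \<in> V \<Longrightarrow> l (\<lambda>t. c *\<^sub>R w t) = c * l w"
proof -
  have "\<exists>K\<in>{K. Q \<subseteq> K \<and> proper_cone K}. \<forall>K'\<in>{K. Q \<subseteq> K \<and> proper_cone K}. K \<subseteq> K' \<longrightarrow> K' = K"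
  proof (rule subset_Zorn_nonempty)
    show "{K. Q \<subseteq> K \<and> proper_cone K} \<noteq> {}" using Q by blast
  next
    fix \<C> assume ne: "\<C> \<noteq> {}" and chain: "subset.chain {K. Q \<subseteq> K \<and> proper_cone K} \<C>"
    have mem: "Q \<subseteq> K" "proper_cone K" if "K \<in> \<C>" for K
      using chain that by (auto simp: subset.chain_def)
    have cone: "pointwise_cone K" if "K \<in> \<C>" for K using mem(2)[OF that] by (simp add: proper_cone_def)
    have "pointwise_cone (\<Union>\<C>)"
      unfolding pointwise_cone_def
    proof (intro conjI allI impI)
      show "((\<lambda>_. 0), 0) \<in> \<Union>\<C>" using ne cone pointwise_coneD(1) by blast
    next
      fix w r w' r' assume "(w, r) \<in> \<Union>\<C>" "(w', r') \<in> \<Union>\<C>"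
      then obtain K K' where "K \<in> \<C>" "K' \<in> \<C>" "(w, r) \<in> K" "(w', r') \<in> K'" by blast
      moreover from this have "K \<subseteq> K' \<or> K' \<subseteq> K" using chain unfolding subset_chain_def by blast
      ultimately obtain K'' where "K'' \<in> \<C>" "(w, r) \<in> K''" "(w', r') \<in> K''"
        by (metis subsetD)
      then show "(\<lambda>t. w t + w' t, r + r') \<in> \<Union>\<C>" using pointwise_coneD(2)[OF cone] by blast
    next
      fix w r and c :: real assume "(w, r) \<in> \<Union>\<C>" "c > 0"
      then show "(\<lambda>t. c *\<^sub>R w t, c * r) \<in> \<Union>\<C>"
        using pointwise_coneD(3)[OF cone, of _ w r c] by auto
    qed
    moreover have "r \<ge> 0" if "((\<lambda>_. 0), r) \<in> \<Union>\<C>" for r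
      using that mem(2) by (auto simp: proper_cone_def)
    moreover have "Q \<subseteq> \<Union>\<C>" using ne mem(1) by blast
    ultimately show "\<Union>\<C> \<in> {K. Q \<subseteq> K \<and> proper_cone K}"
      by (simp add: proper_cone_def)
  qed
  then obtain K where "K \<in> {K. Q \<subseteq> K \<and> proper_cone K}"
    and max': "\<forall>K'\<in>{K. Q \<subseteq> K \<and> proper_cone K}. K \<subseteq> K' \<longrightarrow> K' = K"
    by (elim bexE)
  then have QK: "Q \<subseteq> K" and K: "proper_cone K" by simp_all
  have max: "K' = K" if "proper_cone K'" "K \<subseteq> K'" for K'
    using max' that QK subset_trans by simp
  have cK: "pointwise_cone K" using K by (simp add: proper_cone_def)
  have nonneg: "r + r' \<ge> 0" if "(w, r) \<in> K" "((\<lambda>t. - w t), r') \<in> K" for w r r'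
    using pointwise_coneD(2)[OF cK that] K by (auto simp: proper_cone_def)
  have ex: "\<exists>\<rho>. (w, \<rho>) \<in> K \<and> ((\<lambda>t. - w t), - \<rho>) \<in> K" if w: "w \<in> V" for w
  proof -
    obtain r0 r1 where r: "(w, r0) \<in> K" "((\<lambda>t. - w t), r1) \<in> K"
      using V w QK by (metis subsetD)
    let ?R = "{r. (w, r) \<in> K}"
    have bdd: "bdd_below ?R" using nonneg[OF _ r(2)] by (intro bdd_belowI[of _ "- r1"]) force
    \<comment> \<open>Values at \<open>w\<close> and \<open>- w\<close> have nonnegative sum, so the
      infimum meets the extension criterion at \<open>w\<close>, and its negative meets the
      criterion at \<open>- w\<close>.\<close>
    have "(w, Inf ?R) \<in> K"
    proof (rule maximal_proper_cone_mem[OF K max])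
      fix r assume "((\<lambda>t. - w t), r) \<in> K"
      from nonneg[OF _ this] have "- r \<le> Inf ?R" using r(1) by (intro cInf_greatest) force+
      then show "r \<ge> - Inf ?R" by simp
    qed
    moreover have "((\<lambda>t. - w t), - Inf ?R) \<in> K"
      by (rule maximal_proper_cone_mem[OF K max]) (auto intro: cInf_lower[OF _ bdd])
    ultimately show ?thesis by blast
  qed
  define l where "l w = (SOME \<rho>. (w, \<rho>) \<in> K \<and> ((\<lambda>t. - w t), - \<rho>) \<in> K)" for w
  have l: "(w, l w) \<in> K" "((\<lambda>t. - w t), - l w) \<in> K" if "w \<in> V" for w
    using someI_ex[OF ex[OF that]] by (auto simp: l_def)
  have le: "l w \<le> r" if "w \<in> V" "(w, r) \<in> K" for w r
    using nonneg[OF that(2) l(2)[OF that(1)]] by simp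
  have eq: "l w = r" if "w \<in> V" "(w, r) \<in> K" "((\<lambda>t. - w t), - r) \<in> K" for w r
    using nonneg[OF l(1)[OF that(1)] that(3)] le[OF that(1,2)] by simp
  show thesis
  proof
    show "l w \<le> r" if "w \<in> V" "(w, r) \<in> Q" for w r using le that QK by blast
  next
    fix w w' assume *: "w \<in> V" "w' \<in> V" "(\<lambda>t. w t + w' t) \<in> V"
    show "l (\<lambda>t. w t + w' t) = l w + l w'"
      using pointwise_coneD(2)[OF cK l(1) l(1)] pointwise_coneD(2)[OF cK l(2) l(2)] *
      by (intro eq) (auto simp: algebra_simps)
  next
    fix w and c :: real assume *: "w \<in> V" "c > 0" "(\<lambda>t. c *\<^sub>R w t) \<in> V"
    show "l (\<lambda>t. c *\<^sub>R w t) = c * l w"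
      using pointwise_coneD(3)[OF cK l(1), of w c] pointwise_coneD(3)[OF cK l(2), of w c] *
      by (intro eq) auto
  qed
qed

section \<open>Integral representation of dominated functionals\<close>

text \<open>Adding the integral of \<open>K\<close> shifts \<open>\<nu>\<close> to a nonnegative set
  function below twice that integral. Domination yields countable additivity and absolute continuity
  at once; \<open>K\<close> is subtracted again from the Radon-Nikodym density.\<close>

lemma (in finite_measure) dominated_additive_density:
  fixes \<nu> :: "'a set \<Rightarrow> real"
  assumes K: "integrable M K"
    and dom: "\<And>A. A \<in> sets M \<Longrightarrow> \<bar>\<nu> A\<bar> \<le> (\<integral>x. indicator A x * K x \<partial>M)"
    and add: "\<And>A B. A \<in> sets M \<Longrightarrow> B \<in> sets M \<Longrightarrow> A \<inter> B = {} \<Longrightarrow> \<nu> (A \<union> B) = \<nu> A + \<nu> B"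
  obtains f where "integrable M f" "\<And>A. A \<in> sets M \<Longrightarrow> \<nu> A = (\<integral>x. indicator A x * f x \<partial>M)"
proof -
  define KK where "KK A = (\<integral>x. indicator A x * K x \<partial>M)" for A
  have intK: "integrable M (\<lambda>x. indicator A x * K x)" if "A \<in> sets M" for A
    using integrable_mult_indicator[OF that K] by simp
  define m where "m A = ennreal (\<nu> A + KK A)" for A
  define N where "N = measure_of (space M) (sets M) m"
  have nn: "\<nu> A + KK A \<ge> 0" "\<nu> A + KK A \<le> 2 * KK A" if "A \<in> sets M" for A
    using dom[OF that] by (auto simp: KK_def)
  have KKadd: "KK (A \<union> B) = KK A + KK B" if "A \<in> sets M" "B \<in> sets M" "A \<inter> B = {}" for A B
    unfolding KK_def Bochner_Integration.integral_add[OF intK intK, OF that(1,2), symmetric]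
    by (rule Bochner_Integration.integral_cong) (use that(3) in \<open>auto simp: indicator_def\<close>)
  have mfin: "m A \<noteq> \<infinity>" for A by (simp add: m_def)
  have pos: "positive (sets M) m"
    using add[of "{}" "{}"] by (simp add: positive_def m_def KK_def)
  have "additive (sets M) m"
    unfolding additive_def using nn by (auto simp: m_def add KKadd add_ac simp flip: ennreal_plus)
  \<comment> \<open>Continuity at the empty set upgrades finite to countable additivity; it is
    inherited from the integrals of \<open>K\<close> by dominated convergence.\<close>
  moreover have "(\<lambda>i. m (A i)) \<longlonglongrightarrow> 0"
    if A: "range A \<subseteq> sets M" "decseq A" "(\<Inter>i. A i) = {}" for A
  proof -
    have Ai: "A i \<in> sets M" for i using A by auto
    have "(\<lambda>i. KK (A i)) \<longlonglongrightarrow> (\<integral>x. 0 \<partial>M)"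
      unfolding KK_def
    proof (rule integral_dominated_convergence[where w="\<lambda>x. norm (K x)"])
      show "(\<lambda>x. indicator (A i) x * K x) \<in> borel_measurable M" for i using intK[OF Ai] by auto
      show "integrable M (\<lambda>x. norm (K x))" using K by auto
      show "AE x in M. (\<lambda>i. indicator (A i) x * K x) \<longlonglongrightarrow> 0"
      proof (rule AE_I2)
        fix x
        have "(\<lambda>i. indicator (A i) x :: real) \<longlonglongrightarrow> indicator (\<Inter>i. A i) x"
          by (rule LIMSEQ_indicator_decseq[OF A(2)])
        from tendsto_mult_right[OF this, of "K x"]
        show "(\<lambda>i. indicator (A i) x * K x) \<longlonglongrightarrow> 0" by (simp add: A(3))
      qed
      show "AE x in M. norm (indicator (A i) x * K x) \<le> norm (K x)" for i
        by (auto simp: indicator_def)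
    qed auto
    then have "(\<lambda>i. ennreal (2 * KK (A i))) \<longlonglongrightarrow> ennreal (2 * 0)"
      by (intro tendsto_ennrealI tendsto_intros) simp
    then have "(\<lambda>i. ennreal (2 * KK (A i))) \<longlonglongrightarrow> 0" by simp
    moreover have "m (A i) \<le> ennreal (2 * KK (A i))" for i
      unfolding m_def by (rule ennreal_leI) (rule nn(2)[OF Ai])
    ultimately show ?thesis
      by (intro tendsto_sandwich[of "\<lambda>_. 0" "\<lambda>i. m (A i)"]) auto
  qed
  ultimately have "countably_additive (sets M) m"
    using mfin by (intro sets.empty_continuous_imp_countably_additive pos) auto
  then have N: "emeasure N A = m A" if "A \<in> sets M" for A
    using pos that by (intro emeasure_measure_of[OF N_def]) (auto simp: sets.space_closed N_def)
  have setsN [simp]: "sets N = sets M" and spaceN: "space N = space M" by (simp_all add: N_def)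
  have "finite_measure N" by (rule finite_measureI) (simp add: N spaceN m_def)
  moreover have "absolutely_continuous M N"
    unfolding absolutely_continuous_def null_sets_def
  proof safe
    fix A assume A: "A \<in> sets M" "emeasure M A = 0"
    have "AE x in M. x \<notin> A" using A by (intro AE_not_in) (auto simp: null_sets_def)
    then have "KK A = (\<integral>x. 0 \<partial>M)" unfolding KK_def
      by (intro integral_cong_AE) (use intK[OF A(1)] in \<open>auto elim!: eventually_mono\<close>)
    then show "emeasure N A = 0" using nn[OF A(1)] by (simp add: N[OF A(1)] m_def)
  qed simp
  ultimately obtain F where F: "F \<in> borel_measurable M" "density M F = N"
    using Radon_Nikodym_finite_measure[of N] by auto
  have FA: "(\<integral>\<^sup>+x. F x * indicator A x \<partial>M) = ennreal (\<nu> A + KK A)" if "A \<in> sets M" for A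
    using emeasure_density[OF F(1) that] F(2) N[OF that] by (simp add: m_def)
  have "(\<integral>\<^sup>+x. F x \<partial>M) = (\<integral>\<^sup>+x. F x * indicator (space M) x \<partial>M)"
    by (intro nn_integral_cong) simp
  then have "(\<integral>\<^sup>+x. F x \<partial>M) \<noteq> \<infinity>" using FA[of "space M"] by simp
  then have fin: "AE x in M. F x \<noteq> \<infinity>" by (intro nn_integral_PInf_AE F(1)) auto
  define G where "G x = enn2real (F x)" for x
  have GA: "has_bochner_integral M (\<lambda>x. indicator A x * G x) (\<nu> A + KK A)" if A: "A \<in> sets M" for A
  proof (rule has_bochner_integral_nn_integral)
    show "(\<lambda>x. indicator A x * G x) \<in> borel_measurable M"
      using F(1) A unfolding G_def by measurable
    have "(\<integral>\<^sup>+x. ennreal (indicator A x * G x) \<partial>M) = (\<integral>\<^sup>+x. F x * indicator A x \<partial>M)"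
      using fin by (intro nn_integral_cong_AE)
        (auto elim!: eventually_mono simp: G_def indicator_def less_top[symmetric])
    then show "(\<integral>\<^sup>+x. ennreal (indicator A x * G x) \<partial>M) = ennreal (\<nu> A + KK A)" by (simp add: FA A)
  qed (use nn(1)[OF A] in \<open>auto simp: G_def\<close>)
  show thesis
  proof
    have "integrable M (\<lambda>x. indicator (space M) x * G x)" using GA[of "space M"] by (auto simp: has_bochner_integral_iff)
    then have "integrable M G" by (rule Bochner_Integration.integrable_cong[THEN iffD1, rotated -1]) auto
    then show "integrable M (\<lambda>x. G x - K x)" using K by auto
    show "\<nu> A = (\<integral>x. indicator A x * (G x - K x) \<partial>M)" if "A \<in> sets M" for A
      using GA[OF that] intK[OF that]
      by (simp add: has_bochner_integral_iff algebra_simps KK_def)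
  qed
qed

text \<open>The space of test functions, an L^infinity of genuine functions: the bound holds at
  every point of the space, and functions agreeing almost everywhere are not identified.\<close>

definition bounded_measurable :: "'t measure \<Rightarrow> ('t \<Rightarrow> 'b::real_normed_vector) set" where
  "bounded_measurable M = {w \<in> borel_measurable M. \<exists>B. \<forall>t\<in>space M. norm (w t) \<le> B}"

lemma bounded_measurableI:
  "w \<in> borel_measurable M \<Longrightarrow> (\<And>t. t \<in> space M \<Longrightarrow> norm (w t) \<le> B) \<Longrightarrow> w \<in> bounded_measurable M"
  by (auto simp: bounded_measurable_def)

lemma bounded_measurableD: "w \<in> bounded_measurable M \<Longrightarrow> w \<in> borel_measurable M"
  by (simp add: bounded_measurable_def)

lemma bounded_measurable_bound:
  assumes "w \<in> bounded_measurable M"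
  obtains B where "B > 0" "\<And>t. t \<in> space M \<Longrightarrow> norm (w t) \<le> B"
proof -
  obtain B where "\<And>t. t \<in> space M \<Longrightarrow> norm (w t) \<le> B"
    using assms by (auto simp: bounded_measurable_def)
  then show thesis by (intro that[of "max B 1"]) (auto simp: le_max_iff_disj)
qed

lemma bounded_measurable_add:
  fixes w :: "'t \<Rightarrow> 'b::{real_normed_vector, second_countable_topology}"
  assumes "w \<in> bounded_measurable M" "w' \<in> bounded_measurable M"
  shows "(\<lambda>t. w t + w' t) \<in> bounded_measurable M"
proof -
  obtain B B' where "\<And>t. t \<in> space M \<Longrightarrow> norm (w t) \<le> B" "\<And>t. t \<in> space M \<Longrightarrow> norm (w' t) \<le> B'"
    using assms by (auto simp: bounded_measurable_def)
  then show ?thesis using assms[THEN bounded_measurableD]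
    by (intro bounded_measurableI[where B="B + B'"]) (auto intro: norm_triangle_mono)
qed

lemma bounded_measurable_scaleR:
  fixes w :: "'t \<Rightarrow> 'b::{real_normed_vector, second_countable_topology}"
  assumes "w \<in> bounded_measurable M"
  shows "(\<lambda>t. c *\<^sub>R w t) \<in> bounded_measurable M"
proof -
  obtain B where "\<And>t. t \<in> space M \<Longrightarrow> norm (w t) \<le> B"
    using assms by (auto simp: bounded_measurable_def)
  then show ?thesis using assms[THEN bounded_measurableD]
    by (intro bounded_measurableI[where B="\<bar>c\<bar> * B"]) (auto intro: mult_left_mono)
qed

lemma bounded_measurable_uminus:
  fixes w :: "'t \<Rightarrow> 'b::{real_normed_vector, second_countable_topology}"
  shows "w \<in> bounded_measurable M \<Longrightarrow> (\<lambda>t. - w t) \<in> bounded_measurable M"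
  using bounded_measurable_scaleR[of w M "-1"] by simp

lemma integrable_mult_bounded_measurable:
  fixes w :: "'t \<Rightarrow> 'b::{banach, second_countable_topology}"
  assumes "integrable M f" "w \<in> bounded_measurable M"
  shows "integrable M (\<lambda>t. (f t :: real) *\<^sub>R w t)"
proof -
  obtain B where B: "\<And>t. t \<in> space M \<Longrightarrow> norm (w t) \<le> B"
    using assms by (auto simp: bounded_measurable_def)
  show ?thesis
  proof (rule Bochner_Integration.integrable_bound[of M "\<lambda>t. B * norm (f t)"])
    show "integrable M (\<lambda>t. B * norm (f t))" using assms(1) by auto
    show "(\<lambda>t. f t *\<^sub>R w t) \<in> borel_measurable M" using assms bounded_measurableD[OF assms(2)] by auto
    show "AE t in M. norm (f t *\<^sub>R w t) \<le> norm (B * norm (f t))"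
    proof (rule AE_I2)
      fix t assume "t \<in> space M"
      from mult_left_mono[OF B[OF this], of "\<bar>f t\<bar>"] show "norm (f t *\<^sub>R w t) \<le> norm (B * norm (f t))"
        by (simp add: mult.commute)
    qed
  qed
qed

lemma bounded_measurable_norm:
  "w \<in> bounded_measurable M \<Longrightarrow> (\<lambda>t. norm (w t)) \<in> bounded_measurable M"
  by (auto simp: bounded_measurable_def)

lemma bounded_measurable_inner:
  fixes w :: "'t \<Rightarrow> 'b::euclidean_space"
  assumes "w \<in> bounded_measurable M"
  shows "(\<lambda>t. w t \<bullet> b) \<in> bounded_measurable M"
proof -
  obtain B where B: "\<And>t. t \<in> space M \<Longrightarrow> norm (w t) \<le> B"
    using assms by (auto simp: bounded_measurable_def)
  show ?thesis
  proof (rule bounded_measurableI)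
    show "norm (w t \<bullet> b) \<le> B * norm b" if "t \<in> space M" for t
      using Cauchy_Schwarz_ineq2[of "w t" b] mult_right_mono[OF B[OF that], of "norm b"] by simp
  qed (use bounded_measurableD[OF assms] in auto)
qed

lemma integrable_inner_bounded_measurable:
  fixes z w :: "'t \<Rightarrow> 'b::euclidean_space"
  assumes z: "integrable M z" and w: "w \<in> bounded_measurable M"
  shows "integrable M (\<lambda>t. z t \<bullet> w t)"
proof -
  have "integrable M (\<lambda>t. \<Sum>b\<in>Basis. (z t \<bullet> b) *\<^sub>R (w t \<bullet> b))"
    by (intro Bochner_Integration.integrable_sum integrable_mult_bounded_measurable
        bounded_measurable_inner w integrable_inner_left) (auto intro: z)
  then show ?thesis by (subst euclidean_inner) simp
qed

text \<open>Boundedness in the supremum norm would permit purely finitely additive functionals. The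
  weighted L^1 bound instead gives densities for the set functions of each basis vector, and the
  same bound extends the formula from simple functions to dominated limits.\<close>

lemma (in finite_measure) bounded_functional_density:
  fixes l :: "('a \<Rightarrow> 'b::euclidean_space) \<Rightarrow> real"
  assumes K: "integrable M K" "\<And>t. K t \<ge> 0"
    and le: "\<And>w. w \<in> bounded_measurable M \<Longrightarrow> l w \<le> (\<integral>t. K t * norm (w t) \<partial>M)"
    and add: "\<And>w w'. w \<in> bounded_measurable M \<Longrightarrow> w' \<in> bounded_measurable M \<Longrightarrow>
      l (\<lambda>t. w t + w' t) = l w + l w'"
    and scale: "\<And>w c. w \<in> bounded_measurable M \<Longrightarrow> c > 0 \<Longrightarrow> l (\<lambda>t. c *\<^sub>R w t) = c * l w"
  obtains z where "integrable M z"
    and "\<And>w. w \<in> bounded_measurable M \<Longrightarrow> l w = (\<integral>t. z t \<bullet> w t \<partial>M)"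
proof -
  let ?V = "bounded_measurable M :: ('a \<Rightarrow> 'b) set"
  have V0: "(\<lambda>_. 0) \<in> ?V" by (rule bounded_measurableI[where B=0]) auto
  have l0: "l (\<lambda>_. 0) = 0" using add[OF V0 V0] by simp
  have lminus: "l (\<lambda>t. - w t) = - l w" if "w \<in> ?V" for w
    using add[OF that bounded_measurable_uminus[OF that]] l0 by simp
  have scale': "l (\<lambda>t. c *\<^sub>R w t) = c * l w" if w: "w \<in> ?V" for w c
  proof (cases c "0 :: real" rule: linorder_cases)
    case less
    have "l (\<lambda>t. - ((- c) *\<^sub>R w t)) = - l (\<lambda>t. (- c) *\<^sub>R w t)"
      by (intro lminus bounded_measurable_scaleR w)
    then show ?thesis using scale[OF w, of "- c"] less by simp
  qed (auto simp: l0 scale w)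
  have diff: "\<bar>l w - l w'\<bar> \<le> (\<integral>t. K t * norm (w t - w' t) \<partial>M)" if w: "w \<in> ?V" "w' \<in> ?V" for w w'
  proof -
    have *: "l w - l w' \<le> (\<integral>t. K t * norm (w t - w' t) \<partial>M)" if w: "w \<in> ?V" "w' \<in> ?V" for w w'
      using add[OF w(1) bounded_measurable_uminus[OF w(2)]] lminus[OF w(2)]
        le[OF bounded_measurable_add[OF w(1) bounded_measurable_uminus[OF w(2)]]] by simp
    show ?thesis using *[OF w] *[OF w(2,1)] by (simp add: norm_minus_commute)
  qed
  have indV: "(\<lambda>t. indicator A t *\<^sub>R c) \<in> ?V" if "A \<in> sets M" for A c
    using that by (intro bounded_measurableI[where B="norm c"]) (auto simp: indicator_def)
  have dens: "\<exists>f. integrable M f \<and> (\<forall>A\<in>sets M. l (\<lambda>t. indicator A t *\<^sub>R b) = (\<integral>t. indicator A t * f t \<partial>M))"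
    if b: "b \<in> Basis" for b
  proof -
    have dom: "\<bar>l (\<lambda>t. indicator A t *\<^sub>R b)\<bar> \<le> (\<integral>t. indicator A t * K t \<partial>M)" if A: "A \<in> sets M" for A
      using diff[OF indV[OF A] V0, of b] b by (simp add: l0 mult.commute)
    have add': "l (\<lambda>t. indicator (A \<union> B) t *\<^sub>R b)
        = l (\<lambda>t. indicator A t *\<^sub>R b) + l (\<lambda>t. indicator B t *\<^sub>R b)"
      if "A \<in> sets M" "B \<in> sets M" "A \<inter> B = {}" for A B
    proof -
      have "(\<lambda>t. indicator (A \<union> B) t *\<^sub>R b) = (\<lambda>t. indicat_real A t *\<^sub>R b + indicator B t *\<^sub>R b)"
        using that(3) by (auto simp: indicator_def fun_eq_iff)
      then show ?thesis using add[OF indV[OF that(1)] indV[OF that(2)]] by simp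
    qed
    show ?thesis
      by (rule dominated_additive_density[OF K(1), of "\<lambda>A. l (\<lambda>t. indicator A t *\<^sub>R b)"])
        (auto intro: dom add')
  qed
  have "\<exists>f. \<forall>b\<in>Basis. integrable M (f b) \<and>
      (\<forall>A\<in>sets M. l (\<lambda>t. indicator A t *\<^sub>R b) = (\<integral>t. indicator A t * f b t \<partial>M))"
    by (rule bchoice) (rule ballI, erule dens)
  then obtain f where f0: "\<forall>b\<in>Basis. integrable M (f b) \<and>
      (\<forall>A\<in>sets M. l (\<lambda>t. indicator A t *\<^sub>R b) = (\<integral>t. indicator A t * f b t \<partial>M))"
    by (elim exE)
  have f: "\<And>b. b \<in> Basis \<Longrightarrow> integrable M (f b)"
    "\<And>b A. b \<in> Basis \<Longrightarrow> A \<in> sets M \<Longrightarrow> l (\<lambda>t. indicator A t *\<^sub>R b) = (\<integral>t. indicator A t * f b t \<partial>M)"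
    using f0 by auto
  define z where "z t = (\<Sum>b\<in>Basis. f b t *\<^sub>R b)" for t
  have z: "integrable M z" unfolding z_def by (intro Bochner_Integration.integrable_sum integrable_scaleR_left f(1))
  have zb: "z t \<bullet> b = f b t" if "b \<in> Basis" for t b
    unfolding z_def using that by simp
  have ind: "l (\<lambda>t. indicator A t *\<^sub>R c) = (\<integral>t. z t \<bullet> (indicator A t *\<^sub>R c) \<partial>M)" if A: "A \<in> sets M" for A c
  proof -
    have sum: "(\<lambda>t. \<Sum>b\<in>S. (c \<bullet> b) *\<^sub>R (indicator A t *\<^sub>R b)) \<in> ?V \<and>
      l (\<lambda>t. \<Sum>b\<in>S. (c \<bullet> b) *\<^sub>R (indicator A t *\<^sub>R b)) = (\<Sum>b\<in>S. (c \<bullet> b) * l (\<lambda>t. indicator A t *\<^sub>R b))"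
      if "finite S" for S
      using that
    proof (induction S rule: finite_induct)
      case (insert b S)
      have *: "(\<lambda>t. (c \<bullet> b) *\<^sub>R (indicator A t *\<^sub>R b)) \<in> ?V"
        by (intro bounded_measurable_scaleR indV A)
      from insert.IH show ?case
        using bounded_measurable_add[OF *] add[OF *] insert.hyps
        by (simp add: scale'[OF indV[OF A]] del: scaleR_scaleR)
    qed (simp add: l0 V0)
    have "indicator A t *\<^sub>R c = (\<Sum>b\<in>Basis. (c \<bullet> b) *\<^sub>R (indicat_real A t *\<^sub>R b))" for t
    proof -
      have "indicator A t *\<^sub>R c = indicat_real A t *\<^sub>R (\<Sum>b\<in>Basis. (c \<bullet> b) *\<^sub>R b)"
        by (simp only: euclidean_representation)
      then show ?thesis by (simp only: scaleR_sum_right scaleR_left_commute)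
    qed
    then have "(\<lambda>t. indicator A t *\<^sub>R c) = (\<lambda>t. \<Sum>b\<in>Basis. (c \<bullet> b) *\<^sub>R (indicat_real A t *\<^sub>R b))"
      by (rule ext)
    then have "l (\<lambda>t. indicator A t *\<^sub>R c) = (\<Sum>b\<in>Basis. (c \<bullet> b) * (\<integral>t. indicator A t * f b t \<partial>M))"
      using sum[OF finite_Basis] by (simp add: f(2) A)
    also have "\<dots> = (\<integral>t. (\<Sum>b\<in>Basis. (c \<bullet> b) * (indicator A t * f b t)) \<partial>M)"
      using integrable_mult_indicator[OF A f(1)] by simp
    also have "\<dots> = (\<integral>t. z t \<bullet> (indicator A t *\<^sub>R c) \<partial>M)"
    proof (rule Bochner_Integration.integral_cong[OF refl])
      fix t
      show "(\<Sum>b\<in>Basis. (c \<bullet> b) * (indicator A t * f b t)) = z t \<bullet> (indicator A t *\<^sub>R c)"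
        by (subst euclidean_inner[of "z t"]) (rule sum.cong, auto simp: zb)
    qed
    finally show ?thesis .
  qed
  have simple: "s \<in> ?V \<and> l s = (\<integral>t. z t \<bullet> s t \<partial>M)" if "simple_function M s" for s
  proof -
    have "emeasure M {y \<in> space M. s y \<noteq> 0} \<noteq> \<infinity>" by simp
    with that show ?thesis
    proof (induction s rule: integrable_simple_function_induct)
      \<comment> \<open>\<open>f\<close> and \<open>g\<close> agree on the space but may differ
        outside it. The integral bound on differences shows that \<open>l\<close> cannot distinguish
        them.\<close>
      case (cong f g)
      then obtain B where "\<And>t. t \<in> space M \<Longrightarrow> norm (f t) \<le> B"
        by (auto simp: bounded_measurable_def)
      then have g: "g \<in> ?V" using cong
        by (intro bounded_measurableI[where B=B] borel_measurable_simple_function) auto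
      have "(\<integral>t. K t * norm (f t - g t) \<partial>M) = (\<integral>t. 0 \<partial>M)"
        by (rule Bochner_Integration.integral_cong) (use cong in auto)
      then have "l f = l g" using diff[of f g] g cong by simp
      moreover have "(\<integral>t. z t \<bullet> f t \<partial>M) = (\<integral>t. z t \<bullet> g t \<partial>M)"
        by (rule Bochner_Integration.integral_cong) (use cong in auto)
      ultimately show ?case using g cong by simp
    next
      case (indicator A y) then show ?case using ind indV by blast
    next
      case (add f g)
      then show ?case using bounded_measurable_add[of f M g] assms(4)[of f g]
        by (simp add: inner_add_right integrable_inner_bounded_measurable z)
    qed
  qed
  show thesis
  proof
    fix w :: "'a \<Rightarrow> 'b" assume w: "w \<in> ?V"
    obtain B where B: "\<And>t. t \<in> space M \<Longrightarrow> norm (w t) \<le> B"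
      by (rule bounded_measurable_bound[OF w]) blast
    have "integrable M w"
      by (rule integrable_const_bound[where B=B]) (simp_all add: B bounded_measurableD[OF w])
    then obtain s where s: "\<And>i. simple_function M (s i)"
      "\<And>t. t \<in> space M \<Longrightarrow> (\<lambda>i. s i t) \<longlonglongrightarrow> w t"
      "\<And>t i. t \<in> space M \<Longrightarrow> norm (s i t) \<le> 2 * norm (w t)"
      by (rule integrable_implies_simple_function_sequence) blast
    have sV: "s i \<in> ?V" and ls: "l (s i) = (\<integral>t. z t \<bullet> s i t \<partial>M)" for i using simple[OF s(1)] by auto
    have [measurable]: "s i \<in> borel_measurable M" "w \<in> borel_measurable M" "z \<in> borel_measurable M"
      "K \<in> borel_measurable M" for i
      using bounded_measurableD sV w z K by auto
    have sB: "norm (s i t) \<le> 2 * B" if "t \<in> space M" for i t using s(3)[of t i] B[of t] that by force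
    have "(\<lambda>i. \<integral>t. z t \<bullet> s i t \<partial>M) \<longlonglongrightarrow> (\<integral>t. z t \<bullet> w t \<partial>M)"
    proof (rule integral_dominated_convergence[where w="\<lambda>t. norm (z t) * (2 * B)"])
      show "AE t in M. (\<lambda>i. z t \<bullet> s i t) \<longlonglongrightarrow> z t \<bullet> w t" using s(2) by (auto intro!: AE_I2 tendsto_intros)
      show "AE t in M. norm (z t \<bullet> s i t) \<le> norm (z t) * (2 * B)" for i
      proof (rule AE_I2)
        fix t assume "t \<in> space M"
        from mult_left_mono[OF sB[OF this], of "norm (z t)" i] show "norm (z t \<bullet> s i t) \<le> norm (z t) * (2 * B)"
          using Cauchy_Schwarz_ineq2[of "z t" "s i t"] by simp
      qed
    qed (use z in auto)
    moreover have "(\<lambda>i. l (s i)) \<longlonglongrightarrow> l w"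
    proof -
      have "(\<lambda>i. \<integral>t. K t * norm (s i t - w t) \<partial>M) \<longlonglongrightarrow> (\<integral>t. 0 \<partial>M)"
      \<comment> \<open>The simple functions are bounded by \<open>2 * B\<close> and the limit by
        \<open>B\<close>, hence the factor 3.\<close>
      proof (rule integral_dominated_convergence[where w="\<lambda>t. K t * (3 * B)"])
        show "AE t in M. (\<lambda>i. K t * norm (s i t - w t)) \<longlonglongrightarrow> 0"
          using s(2) by (auto intro!: AE_I2 tendsto_mult_right_zero tendsto_norm_zero LIM_zero)
        show "AE t in M. norm (K t * norm (s i t - w t)) \<le> K t * (3 * B)" for i
        proof (rule AE_I2)
          fix t assume t: "t \<in> space M"
          have "norm (s i t - w t) \<le> 3 * B"
            using sB[OF t, of i] B[OF t] norm_triangle_ineq4[of "s i t" "w t"] by linarith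
          then show "norm (K t * norm (s i t - w t)) \<le> K t * (3 * B)"
            using K(2)[of t] by (simp add: mult_left_mono)
        qed
      qed (use K in auto)
      then have "(\<lambda>i. \<integral>t. K t * norm (s i t - w t) \<partial>M) \<longlonglongrightarrow> 0" by simp
      then have "(\<lambda>i. l (s i) - l w) \<longlonglongrightarrow> 0"
        by (rule Lim_null_comparison[rotated]) (use diff[OF sV w] in auto)
      then show ?thesis by (simp add: LIM_zero_iff)
    qed
    ultimately show "l w = (\<integral>t. z t \<bullet> w t \<partial>M)" unfolding ls by (rule LIMSEQ_unique[rotated])
  qed (fact z)
qed

section \<open>Integrable multipliers\<close>

text \<open>The weights \<open>b / (a + b)\<close> and \<open>a / (a + b)\<close> give both summands
  the same coefficient. This makes the cone of directions with unspecified scale closed under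
  addition.\<close>

lemma convex_scaled_add:
  fixes p q :: "'a::real_vector"
  assumes "convex C" "a *\<^sub>R p \<in> C" "b *\<^sub>R q \<in> C" and ab: "a > 0" "b > 0"
  shows "(a * b / (a + b)) *\<^sub>R (p + q) \<in> C"
proof -
  have "b / (a + b) + a / (a + b) = 1" using ab by (simp add: add_divide_distrib[symmetric])
  then have "(b / (a + b)) *\<^sub>R (a *\<^sub>R p) + (a / (a + b)) *\<^sub>R (b *\<^sub>R q) \<in> C"
    using ab by (intro convexD[OF assms(1-3)]) auto
  then show ?thesis by (simp add: scaleR_add_right mult.commute)
qed

text \<open>A strict violation at one point of \<open>C\<close> is an open condition near a limit of
  interior points, so it would also occur at a point of \<open>D\<close> inside
  \<open>C\<close>.\<close>

lemma convex_halfspace_dense: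
  fixes C :: "'a::euclidean_space set"
  assumes C: "convex C" "interior C \<noteq> {}"
    and D: "\<And>X. open X \<Longrightarrow> X \<noteq> {} \<Longrightarrow> \<exists>d\<in>D. d \<in> X"
    and le: "\<And>d. d \<in> D \<Longrightarrow> d \<in> C \<Longrightarrow> n \<bullet> d \<le> 0" and p: "p \<in> C"
  shows "n \<bullet> p \<le> 0"
proof (rule ccontr)
  assume "\<not> n \<bullet> p \<le> 0"
  moreover have "p \<in> closure (interior C)"
    using convex_closure_interior[OF C] closure_subset p by auto
  moreover have "open {q. n \<bullet> q > 0}" by (rule open_halfspace_gt)
  ultimately have "{q. n \<bullet> q > 0} \<inter> interior C \<noteq> {}"
    using open_Int_closure_eq_empty[of "{q. n \<bullet> q > 0}" "interior C"]
    by (auto simp: disjoint_iff not_le)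
  with D[of "{q. n \<bullet> q > 0} \<inter> interior C"] obtain d where "d \<in> D" "n \<bullet> d > 0" "d \<in> interior C"
    using open_halfspace_gt[of 0 n] by (auto simp: inner_commute)
  with le[of d] interior_subset show False by force
qed

text \<open>\<open>C t\<close> stands for a feasible set translated so that its reference point is
  0. The premise \<open>key\<close> makes the perturbation problem proper, \<open>sel\<close> bounds
  its value in L^1. Testing the resulting functional on \<open>- G t u\<close> yields the adjoint
  identity, and on indicators times \<open>p\<close> the pointwise normality.\<close>

lemma (in finite_measure) integral_multiplier:
  fixes C :: "'a \<Rightarrow> ('z::euclidean_space \<times> 'y::euclidean_space) set"
    and G :: "'a \<Rightarrow> 'x::real_inner \<Rightarrow> 'z"
  assumes lin: "\<And>t. t \<in> space M \<Longrightarrow> linear (G t)"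
    and G: "\<And>u. (\<lambda>t. G t u) \<in> bounded_measurable M"
    and conv: "\<And>t. t \<in> space M \<Longrightarrow> convex (C t)"
    and zero: "AE t in M. 0 \<in> C t" and interior: "AE t in M. interior (C t) \<noteq> {}"
    and meas: "\<And>p. {t \<in> space M. p \<in> C t} \<in> sets M"
    and r: "r > 0" and K: "integrable M K" "\<And>t. K t \<ge> 0"
    and sel: "\<And>h. h \<in> borel_measurable M \<Longrightarrow> (\<And>t. t \<in> space M \<Longrightarrow> norm (h t) \<le> r) \<Longrightarrow>
      \<exists>y\<in>borel_measurable M. AE t in M. (h t, y t) \<in> C t \<and> norm (y t) \<le> K t"
    and key: "\<And>u v. integrable M v \<Longrightarrow> (AE t in M. (G t u, v t) \<in> C t) \<Longrightarrow>
      xs \<bullet> u \<le> ys \<bullet> integral\<^sup>L M v"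
  obtains z where "integrable M z"
    and "AE t in M. \<forall>p\<in>C t. (z t, - ys) \<bullet> p \<le> 0"
    and "\<And>u. (\<integral>t. z t \<bullet> G t u \<partial>M) = xs \<bullet> u"
proof -
  \<comment> \<open>The scale \<open>e\<close> must not depend on \<open>t\<close>: only then can it
    be moved onto \<open>u\<close> and \<open>v\<close> as a whole and \<open>key\<close> be
    applied.\<close>
  define Q :: "(('a \<Rightarrow> 'z) \<times> real) set" where
    "Q = {(w, \<rho>). \<exists>u v e. e > 0 \<and> integrable M v \<and> \<rho> = ys \<bullet> integral\<^sup>L M v - xs \<bullet> u \<and>
      (AE t in M. e *\<^sub>R (w t + G t u, v t) \<in> C t)}"
  have QI: "(w, \<rho>) \<in> Q" if "e > 0" "integrable M v" "\<rho> = ys \<bullet> integral\<^sup>L M v - xs \<bullet> u"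
    "AE t in M. e *\<^sub>R (w t + G t u, v t) \<in> C t" for w \<rho> u v e
    using that unfolding Q_def by blast
  have "pointwise_cone Q"
    unfolding pointwise_cone_def
  proof (intro conjI allI impI)
    have "AE t in M. 1 *\<^sub>R (0 + G t 0, 0) \<in> C t"
      using zero AE_space by eventually_elim (simp add: linear_0[OF lin] zero_prod_def[symmetric])
    then show "((\<lambda>_. 0), 0) \<in> Q" by (intro QI[of 1 "\<lambda>_. 0" 0 0]) auto
  next
    fix w1 r1 w2 r2 assume "(w1, r1) \<in> Q" "(w2, r2) \<in> Q"
    then obtain u1 v1 e1 u2 v2 e2 where *: "e1 > 0" "integrable M v1" "r1 = ys \<bullet> integral\<^sup>L M v1 - xs \<bullet> u1"
      "AE t in M. e1 *\<^sub>R (w1 t + G t u1, v1 t) \<in> C t"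
      "e2 > 0" "integrable M v2" "r2 = ys \<bullet> integral\<^sup>L M v2 - xs \<bullet> u2"
      "AE t in M. e2 *\<^sub>R (w2 t + G t u2, v2 t) \<in> C t" unfolding Q_def by blast
    have "AE t in M. (e1 * e2 / (e1 + e2)) *\<^sub>R (w1 t + w2 t + G t (u1 + u2), v1 t + v2 t) \<in> C t"
      using *(4,8) AE_space
    proof eventually_elim
      case (elim t)
      from convex_scaled_add[OF conv[OF elim(3)] elim(1,2) *(1,5)] show ?case
        by (simp add: linear_add[OF lin[OF elim(3)]] add_ac)
    qed
    then show "(\<lambda>t. w1 t + w2 t, r1 + r2) \<in> Q"
      using * by (intro QI[of "e1 * e2 / (e1 + e2)" "\<lambda>t. v1 t + v2 t" _ "u1 + u2"])
        (auto simp: inner_add_right)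
  next
    fix w \<rho> and c :: real assume "(w, \<rho>) \<in> Q" and c: "c > 0"
    then obtain u v e where *: "e > 0" "integrable M v" "\<rho> = ys \<bullet> integral\<^sup>L M v - xs \<bullet> u"
      "AE t in M. e *\<^sub>R (w t + G t u, v t) \<in> C t" unfolding Q_def by blast
    have "AE t in M. (e / c) *\<^sub>R (c *\<^sub>R w t + G t (c *\<^sub>R u), c *\<^sub>R v t) \<in> C t"
      using *(4) AE_space
      by eventually_elim (use c in \<open>simp add: linear_scale[OF lin] scaleR_add_right\<close>)
    then show "(\<lambda>t. c *\<^sub>R w t, c * \<rho>) \<in> Q"
      using * c by (intro QI[of "e / c" "\<lambda>t. c *\<^sub>R v t" _ "c *\<^sub>R u"]) (auto simp: *(3) right_diff_distrib)
  qed
  moreover have "\<rho> \<ge> 0" if "((\<lambda>_. 0), \<rho>) \<in> Q" for \<rho>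
  proof -
    from that obtain u v e where *: "e > 0" "integrable M v" "\<rho> = ys \<bullet> integral\<^sup>L M v - xs \<bullet> u"
      "AE t in M. e *\<^sub>R (0 + G t u, v t) \<in> C t" unfolding Q_def by blast
    have "AE t in M. (G t (e *\<^sub>R u), e *\<^sub>R v t) \<in> C t"
      using *(4) AE_space by eventually_elim (simp add: linear_scale[OF lin])
    from key[OF _ this] have "e * (xs \<bullet> u) \<le> e * (ys \<bullet> integral\<^sup>L M v)" using *(2) by simp
    then show ?thesis using *(1,3) by simp
  qed
  ultimately have Q: "proper_cone Q" by (simp add: proper_cone_def)
  \<comment> \<open>From \<open>v = (norm w / r) y\<close> with \<open>norm y \<le> K\<close>, by
    Cauchy-Schwarz.\<close>
  define K' where "K' t = norm ys * K t / r" for t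
  have K': "integrable M K'" "\<And>t. K' t \<ge> 0" using K r by (auto simp: K'_def[abs_def])
  have dom: "\<exists>\<rho>. (w, \<rho>) \<in> Q \<and> \<rho> \<le> (\<integral>t. K' t * norm (w t) \<partial>M)" if w: "w \<in> bounded_measurable M" for w
  proof -
    obtain B where B: "B > 0" "\<And>t. t \<in> space M \<Longrightarrow> norm (w t) \<le> B"
      by (rule bounded_measurable_bound[OF w]) blast
    have [measurable]: "w \<in> borel_measurable M" using w by (rule bounded_measurableD)
    \<comment> \<open>The shift is stretched to length \<open>r\<close>, where a bounded selection
      is available; where \<open>w t = 0\<close>, division by zero gives
      \<open>h t = 0\<close>.\<close>
    define h where "h t = (r / norm (w t)) *\<^sub>R w t" for t
    have "h \<in> borel_measurable M" unfolding h_def by measurable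
    moreover have "norm (h t) \<le> r" for t using r by (simp add: h_def)
    ultimately obtain y where y: "y \<in> borel_measurable M" "AE t in M. (h t, y t) \<in> C t \<and> norm (y t) \<le> K t"
      using sel[of h] by auto
    define v where "v t = (norm (w t) / r) *\<^sub>R y t" for t
    have inty: "integrable M y"
      by (rule Bochner_Integration.integrable_bound[OF K(1) y(1)]) (use y(2) K(2) in \<open>auto elim!: eventually_mono\<close>)
    have intv: "integrable M v"
    proof (rule Bochner_Integration.integrable_bound[of M "\<lambda>t. (B / r) *\<^sub>R y t"])
      show "integrable M (\<lambda>t. (B / r) *\<^sub>R y t)" using inty by simp
      show "v \<in> borel_measurable M" using y(1) unfolding v_def by measurable
      show "AE t in M. norm (v t) \<le> norm ((B / r) *\<^sub>R y t)"
        using AE_space by eventually_elim (use B r in \<open>auto simp: v_def intro!: mult_right_mono divide_right_mono\<close>)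
    qed
    \<comment> \<open>This point is \<open>(norm (w t) / B) *\<^sub>R (h t, y t)\<close>, on the
      segment from 0 to a feasible point. The global bound \<open>B\<close> makes the scale
      \<open>r / B\<close> uniform in \<open>t\<close>.\<close>
    have "AE t in M. (r / B) *\<^sub>R (w t + G t 0, v t) \<in> C t"
      using y(2) zero AE_space
    proof eventually_elim
      case (elim t)
      have "norm (w t) / B \<le> 1" "norm (w t) / B \<ge> 0" using B elim(3) by auto
      then have "(norm (w t) / B) *\<^sub>R (h t, y t) \<in> C t"
        using convexD_alt[OF conv[OF elim(3)] elim(2), of "(h t, y t)" "norm (w t) / B"] elim(1) by simp
      then show ?case using r B by (cases "w t = 0") (auto simp: h_def v_def linear_0[OF lin[OF elim(3)]])
    qed
    then have "(w, ys \<bullet> integral\<^sup>L M v) \<in> Q" using r B intv by (intro QI[of "r / B" v _ 0]) auto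
    moreover have "ys \<bullet> integral\<^sup>L M v = (\<integral>t. ys \<bullet> v t \<partial>M)" using intv by simp
    moreover have "\<dots> \<le> (\<integral>t. K' t * norm (w t) \<partial>M)"
    proof (rule integral_mono_AE)
      show "integrable M (\<lambda>t. ys \<bullet> v t)" using intv by simp
      show "integrable M (\<lambda>t. K' t * norm (w t))"
        using integrable_mult_bounded_measurable[OF K'(1) bounded_measurable_norm[OF w]] by simp
      show "AE t in M. ys \<bullet> v t \<le> K' t * norm (w t)"
        using y(2)
      proof eventually_elim
        case (elim t)
        have "ys \<bullet> v t \<le> norm ys * norm (v t)" by (rule norm_cauchy_schwarz)
        also have "\<dots> \<le> norm ys * (norm (w t) / r * K t)"
          unfolding v_def using elim r by (auto intro!: mult_left_mono divide_right_mono)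
        also have "\<dots> = K' t * norm (w t)" by (simp add: K'_def)
        finally show ?case .
      qed
    qed
    ultimately show ?thesis by auto
  qed
  obtain l where l: "\<And>w \<rho>. w \<in> bounded_measurable M \<Longrightarrow> (w, \<rho>) \<in> Q \<Longrightarrow> l w \<le> \<rho>"
    and add: "\<And>w w'. w \<in> bounded_measurable M \<Longrightarrow> w' \<in> bounded_measurable M \<Longrightarrow>
      (\<lambda>t. w t + w' t) \<in> bounded_measurable M \<Longrightarrow> l (\<lambda>t. w t + w' t) = l w + l w'"
    and scale: "\<And>w c. w \<in> bounded_measurable M \<Longrightarrow> c > 0 \<Longrightarrow>
      (\<lambda>t. c *\<^sub>R w t) \<in> bounded_measurable M \<Longrightarrow> l (\<lambda>t. c *\<^sub>R w t) = c * l w"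
    by (rule linear_minorant_of_cone[OF Q, of "bounded_measurable M"])
      (use dom bounded_measurable_uminus in blast)+
  have lK: "l w \<le> (\<integral>t. K' t * norm (w t) \<partial>M)" if "w \<in> bounded_measurable M" for w
    using dom[OF that] l[OF that] by force
  obtain z where z: "integrable M z"
    and lz: "\<And>w. w \<in> bounded_measurable M \<Longrightarrow> l w = (\<integral>t. z t \<bullet> w t \<partial>M)"
    by (rule bounded_functional_density[OF K' lK add scale])
      (auto intro: bounded_measurable_add bounded_measurable_scaleR)
  have [measurable]: "z \<in> borel_measurable M" using z by simp
  show thesis
  proof
    show "integrable M z" by (fact z)
  next
    fix u
    have ge: "xs \<bullet> u \<le> (\<integral>t. z t \<bullet> G t u \<partial>M)" for u
    proof -
      \<comment> \<open>The perturbation \<open>- G t u\<close> is cancelled by moving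
        \<open>x\<close> along \<open>u\<close> with \<open>v = 0\<close>, at cost
        \<open>- (xs \<bullet> u)\<close>. Applying this to \<open>u\<close> and \<open>- u\<close>
        gives equality.\<close>
      have V: "(\<lambda>t. - G t u) \<in> bounded_measurable M" by (rule bounded_measurable_uminus[OF G])
      have "AE t in M. 1 *\<^sub>R (- G t u + G t u, 0) \<in> C t"
        using zero by eventually_elim (simp add: zero_prod_def)
      then have "((\<lambda>t. - G t u), - (xs \<bullet> u)) \<in> Q" by (intro QI[of 1 "\<lambda>_. 0" _ u]) auto
      from l[OF V this] lz[OF V] show ?thesis by simp
    qed
    have "(\<integral>t. z t \<bullet> G t (- u) \<partial>M) = (\<integral>t. - (z t \<bullet> G t u) \<partial>M)"
      by (rule Bochner_Integration.integral_cong) (auto simp: linear_neg[OF lin])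
    with ge[of u] ge[of "- u"] show "(\<integral>t. z t \<bullet> G t u \<partial>M) = xs \<bullet> u" by simp
  next
    obtain D :: "('z \<times> 'y) set" where D: "countable D" "\<And>X. open X \<Longrightarrow> X \<noteq> {} \<Longrightarrow> \<exists>d\<in>D. d \<in> X"
      by (rule countable_dense_setE) blast
    have "AE t in M. p \<in> C t \<longrightarrow> (z t, - ys) \<bullet> p \<le> 0" for p
    proof -
      define f where "f t = z t \<bullet> fst p - ys \<bullet> snd p" for t
      \<comment> \<open>The set where normality fails at \<open>p\<close>. The test function
        supported there gives a nonpositive integral of a nonnegative function, so \<open>A\<close>
        is null.\<close>
      define A where "A = {t \<in> space M. p \<in> C t} \<inter> {t \<in> space M. f t > 0}"
      have A: "A \<in> sets M" unfolding A_def f_def by (intro sets.Int meas) measurable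
      have V: "(\<lambda>t. indicator A t *\<^sub>R fst p) \<in> bounded_measurable M"
        using A by (intro bounded_measurableI[where B="norm (fst p)"]) (auto simp: indicator_def)
      have int: "integrable M (\<lambda>t. indicator A t *\<^sub>R snd p)"
        using A by (intro integrable_const_bound[where B="norm (snd p)"]) (auto simp: indicator_def)
      have "AE t in M. 1 *\<^sub>R (indicator A t *\<^sub>R fst p + G t 0, indicator A t *\<^sub>R snd p) \<in> C t"
        using zero AE_space
        by eventually_elim (auto simp: indicator_def A_def linear_0[OF lin] zero_prod_def)
      then have "((\<lambda>t. indicator A t *\<^sub>R fst p), ys \<bullet> (\<integral>t. indicator A t *\<^sub>R snd p \<partial>M)) \<in> Q"
        using int by (intro QI[of 1 "\<lambda>t. indicator A t *\<^sub>R snd p" _ 0]) auto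
      from l[OF V this]
      have le: "(\<integral>t. z t \<bullet> (indicator A t *\<^sub>R fst p) \<partial>M) \<le> (\<integral>t. ys \<bullet> (indicator A t *\<^sub>R snd p) \<partial>M)"
        unfolding lz[OF V] integral_inner_right[OF int] .
      have ints: "integrable M (\<lambda>t. z t \<bullet> (indicator A t *\<^sub>R fst p))"
        "integrable M (\<lambda>t. ys \<bullet> (indicator A t *\<^sub>R snd p))"
        by (rule integrable_inner_bounded_measurable[OF z V], rule integrable_inner_right[OF int])
      have fA: "indicator A t * f t = z t \<bullet> (indicator A t *\<^sub>R fst p) - ys \<bullet> (indicator A t *\<^sub>R snd p)" for t
        by (simp add: f_def algebra_simps)
      have intf: "integrable M (\<lambda>t. indicator A t * f t)" unfolding fA by (rule Bochner_Integration.integrable_diff[OF ints])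
      have nn: "AE t in M. 0 \<le> indicator A t * f t" by (auto simp: indicator_def A_def)
      have "(\<integral>t. indicator A t * f t \<partial>M) \<le> 0" unfolding fA Bochner_Integration.integral_diff[OF ints] using le by simp
      with integral_nonneg_AE[OF nn] have "(\<integral>t. indicator A t * f t \<partial>M) = 0" by linarith
      then have "AE t in M. indicator A t * f t = 0" using integral_nonneg_eq_0_iff_AE[OF intf nn] by simp
      then show ?thesis using AE_space
        by eventually_elim (auto simp: indicator_def A_def f_def inner_prod_def split: if_splits)
    qed
    then have "AE t in M. \<forall>d\<in>D. d \<in> C t \<longrightarrow> (z t, - ys) \<bullet> d \<le> 0"
      using D(1) by (simp add: AE_ball_countable)
    then show "AE t in M. \<forall>p\<in>C t. (z t, - ys) \<bullet> p \<le> 0"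
      using interior AE_space
    proof eventually_elim
      case (elim t)
      then show ?case using convex_halfspace_dense[OF conv[OF elim(3)] elim(2) D(2)] by blast
    qed
  qed
qed

section \<open>Selections under a Slater condition\<close>

text \<open>Slater selections are taken only for the shifts \<open>\<eta> b\<close> and
  \<open>- \<eta> b\<close> with \<open>b\<close> in the basis. A measurable shift is a convex
  combination of these with measurable weights once its norm is at most \<open>\<eta>\<close>
  divided by the dimension. The sum of the norms of these selections bounds every combination, hence
  \<open>K\<close> does not depend on \<open>h\<close>.\<close>

lemma measurable_convex_selection:
  fixes S :: "'t \<Rightarrow> ('z::euclidean_space \<times> 'y::euclidean_space) set"
  assumes conv: "\<And>t. t \<in> space M \<Longrightarrow> convex (S t)" and \<eta>: "\<eta> > 0"
    and ex: "\<And>h. norm h \<le> \<eta> \<Longrightarrow> \<exists>y. integrable M y \<and> (AE t in M. (zb t + h, y t) \<in> S t)"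
  obtains r K where "r > 0" "integrable M K" "\<And>t. K t \<ge> 0"
    and "\<And>h. h \<in> borel_measurable M \<Longrightarrow> (\<And>t. t \<in> space M \<Longrightarrow> norm (h t) \<le> r) \<Longrightarrow>
      \<exists>y\<in>borel_measurable M. AE t in M. (zb t + h t, y t) \<in> S t \<and> norm (y t) \<le> (K t :: real)"
proof -
  let ?B = "Basis :: 'z set"
  let ?d = "real DIM('z)"
  have "\<forall>b\<in>?B. \<exists>y. integrable M y \<and> (AE t in M. (zb t + \<eta> *\<^sub>R b, y t) \<in> S t)"
    using \<eta> by (intro ballI ex) simp
  from bchoice[OF this] obtain yp where
    yp: "\<forall>b\<in>?B. integrable M (yp b) \<and> (AE t in M. (zb t + \<eta> *\<^sub>R b, yp b t) \<in> S t)" ..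
  have "\<forall>b\<in>?B. \<exists>y. integrable M y \<and> (AE t in M. (zb t + (- \<eta>) *\<^sub>R b, y t) \<in> S t)"
    using \<eta> by (intro ballI ex) simp
  from bchoice[OF this] obtain ym where
    ym: "\<forall>b\<in>?B. integrable M (ym b) \<and> (AE t in M. (zb t + (- \<eta>) *\<^sub>R b, ym b t) \<in> S t)" ..
  have intp: "integrable M (yp b)" and intm: "integrable M (ym b)" if "b \<in> ?B" for b
    using yp ym that by auto
  have "AE t in M. \<forall>b\<in>?B. (zb t + \<eta> *\<^sub>R b, yp b t) \<in> S t"
    by (rule AE_finite_allI) (use yp in auto)
  moreover have "AE t in M. \<forall>b\<in>?B. (zb t + (- \<eta>) *\<^sub>R b, ym b t) \<in> S t"
    by (rule AE_finite_allI) (use ym in auto)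
  ultimately have AES: "AE t in M. \<forall>b\<in>?B. (zb t + \<eta> *\<^sub>R b, yp b t) \<in> S t \<and> (zb t + (- \<eta>) *\<^sub>R b, ym b t) \<in> S t"
    by eventually_elim simp
  define K where "K t = (\<Sum>b\<in>?B. norm (yp b t) + norm (ym b t))" for t
  have d: "?d \<ge> 1" using DIM_positive[where 'a='z] by linarith
  show thesis
  proof
    show "\<eta> / ?d > 0" using \<eta> d by simp
    show "integrable M K"
      unfolding K_def using intp intm by (intro Bochner_Integration.integrable_sum Bochner_Integration.integrable_add integrable_norm)
    show "K t \<ge> 0" for t unfolding K_def by (intro sum_nonneg) simp
  next
    fix h :: "'t \<Rightarrow> 'z"
    assume h[measurable]: "h \<in> borel_measurable M" and hr: "\<And>t. t \<in> space M \<Longrightarrow> norm (h t) \<le> \<eta> / ?d"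
    \<comment> \<open>Position on the segment in direction \<open>b\<close>, in
      \<open>[-1, 1]\<close>. The factor \<open>?d\<close> compensates for averaging over the
      basis.\<close>
    define s where "s b t = ?d * (h t \<bullet> b) / \<eta>" for b t
    \<comment> \<open>\<open>h t\<close> is the average over the basis of points of the segments from \<open>- \<eta> *\<^sub>R b\<close> to \<open>\<eta> *\<^sub>R b\<close>.\<close>
    define q where "q b t = ((1 + s b t) / 2) *\<^sub>R yp b t + ((1 - s b t) / 2) *\<^sub>R ym b t" for b t
    define y where "y t = (\<Sum>b\<in>?B. (1 / ?d) *\<^sub>R q b t)" for t
    have s1: "\<bar>s b t\<bar> \<le> 1" if "b \<in> ?B" "t \<in> space M" for b t
    proof -
      have "\<bar>h t \<bullet> b\<bar> \<le> \<eta> / ?d" using Basis_le_norm[OF that(1), of "h t"] hr[OF that(2)] by linarith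
      then have "?d * \<bar>h t \<bullet> b\<bar> \<le> \<eta>" using d by (simp add: field_simps)
      then show ?thesis using \<eta> by (simp add: s_def abs_mult)
    qed
    have "q b \<in> borel_measurable M" if "b \<in> ?B" for b
    proof -
      have [measurable]: "yp b \<in> borel_measurable M" "ym b \<in> borel_measurable M"
        using intp[OF that] intm[OF that] by auto
      show ?thesis unfolding q_def s_def by measurable
    qed
    then have "y \<in> borel_measurable M"
      unfolding y_def by (intro borel_measurable_sum borel_measurable_scaleR) auto
    moreover have "AE t in M. (zb t + h t, y t) \<in> S t \<and> norm (y t) \<le> K t"
      using AES AE_space
    proof eventually_elim
      case (elim t)
      have q: "(zb t + (?d * (h t \<bullet> b)) *\<^sub>R b, q b t) \<in> S t" if b: "b \<in> ?B" for b
      proof -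
        have "((1 + s b t) / 2) *\<^sub>R (zb t + \<eta> *\<^sub>R b, yp b t) + ((1 - s b t) / 2) *\<^sub>R (zb t + (- \<eta>) *\<^sub>R b, ym b t) \<in> S t"
          using elim b s1[OF b elim(2)] by (intro convexD[OF conv]) (auto simp: field_simps)
        moreover have "((1 + s b t) / 2) *\<^sub>R (zb t + \<eta> *\<^sub>R b) + ((1 - s b t) / 2) *\<^sub>R (zb t + (- \<eta>) *\<^sub>R b)
          = (((1 + s b t) / 2) + ((1 - s b t) / 2)) *\<^sub>R zb t + (((1 + s b t) / 2) * \<eta> - ((1 - s b t) / 2) * \<eta>) *\<^sub>R b"
          by (simp add: scaleR_add_right scaleR_add_left scaleR_diff_left scaleR_diff_right)
        moreover have "((1 + s b t) / 2) + ((1 - s b t) / 2) = 1" by (simp add: field_simps)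
        moreover have "((1 + s b t) / 2) * \<eta> - ((1 - s b t) / 2) * \<eta> = ?d * (h t \<bullet> b)"
          using \<eta> by (simp add: s_def field_simps)
        ultimately show ?thesis by (simp add: q_def)
      qed
      have "(\<Sum>b\<in>?B. (1 / ?d) *\<^sub>R (zb t + (?d * (h t \<bullet> b)) *\<^sub>R b, q b t)) \<in> S t"
        using q by (intro convex_sum conv elim) auto
      moreover have "(\<Sum>b\<in>?B. (1 / ?d) *\<^sub>R (zb t + (?d * (h t \<bullet> b)) *\<^sub>R b, q b t)) = (zb t + h t, y t)"
      proof -
        have "(\<Sum>b\<in>?B. (1 / ?d) *\<^sub>R (zb t + (?d * (h t \<bullet> b)) *\<^sub>R b)) = (\<Sum>b\<in>?B. (1 / ?d) *\<^sub>R zb t) + (\<Sum>b\<in>?B. (h t \<bullet> b) *\<^sub>R b)"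
          using d by (simp add: scaleR_add_right sum.distrib)
        also have "\<dots> = zb t + h t" using d
          by (simp add: euclidean_representation sum_constant_scaleR)
        finally show ?thesis by (simp add: sum_prod[symmetric] y_def prod_eq_iff fst_sum snd_sum)
      qed
      moreover have "norm (y t) \<le> K t"
        unfolding y_def K_def
      proof (intro order_trans[OF norm_sum] sum_mono)
        fix b assume b: "b \<in> ?B"
        have "norm (q b t) \<le> \<bar>(1 + s b t) / 2\<bar> * norm (yp b t) + \<bar>(1 - s b t) / 2\<bar> * norm (ym b t)"
          unfolding q_def by (rule order_trans[OF norm_triangle_ineq]) simp
        also have "\<dots> \<le> 1 * norm (yp b t) + 1 * norm (ym b t)"
          using s1[OF b elim(2)] by (intro add_mono mult_right_mono) auto
        finally have "norm (q b t) \<le> norm (yp b t) + norm (ym b t)" by simp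
        moreover have "norm ((1 / ?d) *\<^sub>R q b t) \<le> 1 * norm (q b t)"
          unfolding norm_scaleR using d by (intro mult_right_mono) auto
        ultimately show "norm ((1 / ?d) *\<^sub>R q b t) \<le> norm (yp b t) + norm (ym b t)" by linarith
      qed
      ultimately show ?case by simp
    qed
    ultimately show "\<exists>y\<in>borel_measurable M. AE t in M. (zb t + h t, y t) \<in> S t \<and> norm (y t) \<le> K t"
      by blast
  qed
qed

text \<open>Dominated convergence in the shape of the correction errors: a uniformly bounded factor
  that vanishes pointwise, times a fixed integrable function.\<close>

lemma integral_tendsto_zero:
  fixes a :: "nat \<Rightarrow> 't \<Rightarrow> 'b::{banach, second_countable_topology}"
  assumes a: "\<And>k. integrable M (a k)" and H: "integrable M H"
    and le: "\<And>k. AE t in M. norm (a k t) \<le> \<rho> k t * norm (H t :: real)"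
    and \<rho>: "\<And>t. t \<in> space M \<Longrightarrow> (\<lambda>k. \<rho> k t) \<longlonglongrightarrow> 0" "\<And>k t. t \<in> space M \<Longrightarrow> \<rho> k t \<le> B"
  shows "(\<lambda>k. integral\<^sup>L M (a k)) \<longlonglongrightarrow> 0"
proof -
  have "(\<lambda>k. integral\<^sup>L M (a k)) \<longlonglongrightarrow> (\<integral>t. 0 \<partial>M)"
  proof (rule integral_dominated_convergence[where w="\<lambda>t. B * norm (H t)"])
    show "integrable M (\<lambda>t. B * norm (H t))" using H by simp
    show "AE t in M. norm (a k t) \<le> B * norm (H t)" for k
      using le[of k] AE_space
      by eventually_elim (meson \<rho>(2) mult_right_mono norm_ge_zero order_trans)
    have "AE t in M. \<forall>k. norm (a k t) \<le> \<rho> k t * norm (H t)" using le by (simp add: AE_all_countable)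
    then show "AE t in M. (\<lambda>k. a k t) \<longlonglongrightarrow> 0"
      using AE_space
    proof eventually_elim
      case (elim t)
      show ?case
        by (rule Lim_null_comparison[of _ "\<lambda>k. \<rho> k t * norm (H t)"])
          (use elim \<rho>(1)[of t] in \<open>auto intro!: tendsto_mult_left_zero\<close>)
    qed
  qed (use a in auto)
  then show ?thesis by simp
qed

text \<open>\<open>U\<close> is to be a small neighborhood, on which \<open>g\<close> varies by at
  most \<open>r / 6\<close>. A linear step of size at most \<open>r / 6\<close> then stays within
  \<open>r / 3\<close> of \<open>zb\<close>, which leaves \<open>2 * r / 3\<close> for pushing
  toward a Slater selection.\<close>

locale slater_system = finite_measure M for M :: "'t measure" +
  fixes S :: "'t \<Rightarrow> ('z::euclidean_space \<times> 'y::euclidean_space) set"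
    and zb :: "'t \<Rightarrow> 'z" and r :: real and K :: "'t \<Rightarrow> real"
    and g :: "'t \<Rightarrow> 'x::euclidean_space \<Rightarrow> 'z" and G :: "'x \<Rightarrow> 't \<Rightarrow> 'x \<Rightarrow> 'z"
    and U :: "'x set" and L :: real
  assumes conv: "\<And>t. t \<in> space M \<Longrightarrow> convex (S t)"
    and zb_measurable [measurable]: "zb \<in> borel_measurable M"
    and r: "r > 0" and K: "integrable M K" "\<And>t. K t \<ge> 0"
    and sel: "\<And>h. h \<in> borel_measurable M \<Longrightarrow> (\<And>t. t \<in> space M \<Longrightarrow> norm (h t) \<le> r) \<Longrightarrow>
      \<exists>y\<in>borel_measurable M. AE t in M. (zb t + h t, y t) \<in> S t \<and> norm (y t) \<le> K t"
    and U: "open U"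
    and g_measurable: "\<And>x. x \<in> U \<Longrightarrow> (\<lambda>t. g t x) \<in> borel_measurable M"
    and g_lipschitz: "\<And>t x x'. t \<in> space M \<Longrightarrow> x \<in> U \<Longrightarrow> x' \<in> U \<Longrightarrow> norm (g t x - g t x') \<le> L * norm (x - x')"
    and g_derivative: "\<And>t x. t \<in> space M \<Longrightarrow> x \<in> U \<Longrightarrow> (g t has_derivative G x t) (at x)"
    and G_bound: "\<And>t x u. t \<in> space M \<Longrightarrow> x \<in> U \<Longrightarrow> norm (G x t u) \<le> L * norm u"
    and g_near: "\<And>t x. t \<in> space M \<Longrightarrow> x \<in> U \<Longrightarrow> norm (g t x - zb t) \<le> r / 6"
begin

section \<open>Uniform step sizes and measurability of the derivative\<close>

lemma G_linear: "t \<in> space M \<Longrightarrow> x \<in> U \<Longrightarrow> linear (G x t)"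
  using g_derivative has_derivative_linear by blast

lemma admissible_step:
  assumes "x \<in> U"
  obtains \<sigma> where "0 < \<sigma>" "\<sigma> \<le> 1" "\<sigma> * (L * norm u) \<le> r / 6"
    and "\<And>s. 0 \<le> s \<Longrightarrow> s \<le> \<sigma> \<Longrightarrow> x + s *\<^sub>R u \<in> U"
proof -
  obtain e where e: "e > 0" "ball x e \<subseteq> U" using U assms open_contains_ball by blast
  \<comment> \<open>One step length serves all \<open>t\<close> because \<open>L\<close> does. The
    summands 1 keep the denominators positive when \<open>u = 0\<close>, and
    \<open>\<bar>L\<bar>\<close> appears since the sign of \<open>L\<close> is not
    prescribed.\<close>
  define \<sigma> where "\<sigma> = min 1 (min (e / (2 * (norm u + 1))) (r / 6 / (\<bar>L\<bar> * norm u + 1)))"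
  have pos: "norm u + 1 > 0" "\<bar>L\<bar> * norm u + 1 > 0" by (auto simp: add_nonneg_pos)
  show thesis
  proof
    show "0 < \<sigma>" "\<sigma> \<le> 1" using e r pos by (auto simp: \<sigma>_def)
    have "\<sigma> \<le> r / 6 / (\<bar>L\<bar> * norm u + 1)" by (simp add: \<sigma>_def)
    then have "\<sigma> * (\<bar>L\<bar> * norm u + 1) \<le> r / 6" using pos by (simp add: field_simps)
    moreover have "L * norm u \<le> \<bar>L\<bar> * norm u + 1"
      using mult_right_mono[OF abs_ge_self norm_ge_zero, of L u] by linarith
    then have "\<sigma> * (L * norm u) \<le> \<sigma> * (\<bar>L\<bar> * norm u + 1)"
      using \<open>0 < \<sigma>\<close> by (intro mult_left_mono) auto
    ultimately show "\<sigma> * (L * norm u) \<le> r / 6" by linarith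
  next
    fix s assume s: "0 \<le> s" "s \<le> \<sigma>"
    then have "s \<le> e / (2 * (norm u + 1))" by (simp add: \<sigma>_def)
    then have "s * (norm u + 1) \<le> e / 2" using pos by (simp add: field_simps)
    then have "s * norm u < e" using s e by (simp add: algebra_simps)
    then show "x + s *\<^sub>R u \<in> U" using e(2) s by (intro subsetD[OF e(2)]) (simp add: dist_norm)
  qed
qed

lemma difference_quotient_tendsto:
  assumes t: "t \<in> space M" and x: "x \<in> U" and s: "\<And>k. s k > 0" "s \<longlonglongrightarrow> 0"
  shows "(\<lambda>k. (g t (x + s k *\<^sub>R u) - g t x) /\<^sub>R s k) \<longlonglongrightarrow> G x t u"
proof -
  have "((\<lambda>s. x + s *\<^sub>R u) has_derivative (\<lambda>s. s *\<^sub>R u)) (at 0)"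
    by (auto intro!: derivative_eq_intros)
  from has_derivative_compose[OF this, of "g t" "G x t"] g_derivative[OF t x]
  have "((\<lambda>s. g t (x + s *\<^sub>R u)) has_derivative (\<lambda>s. s *\<^sub>R G x t u)) (at 0)"
    by (simp add: linear_scale[OF G_linear[OF t x]])
  then have "((\<lambda>s. norm (g t (x + s *\<^sub>R u) - g t x - s *\<^sub>R G x t u) / norm s) \<longlongrightarrow> 0) (at 0)"
    by (simp add: has_derivative_iff_norm)
  moreover have "\<forall>\<^sub>F s :: real in at 0. norm (g t (x + s *\<^sub>R u) - g t x - s *\<^sub>R G x t u) / norm s
      = norm ((g t (x + s *\<^sub>R u) - g t x) /\<^sub>R s - G x t u)"
  proof (rule eventually_at_filter[THEN iffD2], rule always_eventually, safe)
    fix s :: real assume "s \<noteq> 0"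
    then have "(g t (x + s *\<^sub>R u) - g t x) /\<^sub>R s - G x t u
        = (g t (x + s *\<^sub>R u) - g t x - s *\<^sub>R G x t u) /\<^sub>R s"
      by (simp add: scaleR_diff_right)
    then show "norm (g t (x + s *\<^sub>R u) - g t x - s *\<^sub>R G x t u) / norm s
      = norm ((g t (x + s *\<^sub>R u) - g t x) /\<^sub>R s - G x t u)"
      by (simp add: divide_inverse mult.commute)
  qed
  ultimately have "((\<lambda>s. norm ((g t (x + s *\<^sub>R u) - g t x) /\<^sub>R s - G x t u)) \<longlongrightarrow> 0) (at 0)"
    by (rule Lim_transform_eventually)
  then have "((\<lambda>s. (g t (x + s *\<^sub>R u) - g t x) /\<^sub>R s) \<longlongrightarrow> G x t u) (at 0)"
    by (simp add: tendsto_norm_zero_iff LIM_zero_iff)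
  moreover have "filterlim s (at 0) sequentially"
    using s by (auto simp: filterlim_at less_imp_neq[symmetric])
  ultimately show ?thesis by (rule filterlim_compose)
qed

text \<open>Only \<open>g\<close> is assumed measurable in \<open>t\<close>; its derivative inherits
  this as a pointwise limit of difference quotients.\<close>

lemma G_bounded_measurable:
  assumes x: "x \<in> U"
  shows "(\<lambda>t. G x t u) \<in> bounded_measurable M"
proof (rule bounded_measurableI)
  obtain \<sigma> where \<sigma>: "0 < \<sigma>" "\<And>s. 0 \<le> s \<Longrightarrow> s \<le> \<sigma> \<Longrightarrow> x + s *\<^sub>R u \<in> U"
    using admissible_step[OF x, of u] by metis
  define s where "s k = \<sigma> * inverse (real (Suc k))" for k
  have s: "\<And>k. s k > 0" "s \<longlonglongrightarrow> 0" "\<And>k. s k \<le> \<sigma>"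
    using \<sigma> tendsto_mult[OF tendsto_const LIMSEQ_inverse_real_of_nat, of \<sigma>]
    by (auto simp: s_def[abs_def] mult_le_cancel_left1 inverse_le_1_iff)
  show "(\<lambda>t. G x t u) \<in> borel_measurable M"
  proof (rule borel_measurable_LIMSEQ_metric)
    show "(\<lambda>k. (g t (x + s k *\<^sub>R u) - g t x) /\<^sub>R s k) \<longlonglongrightarrow> G x t u" if "t \<in> space M" for t
      by (rule difference_quotient_tendsto[OF that x s(1,2)])
    show "(\<lambda>t. (g t (x + s k *\<^sub>R u) - g t x) /\<^sub>R s k) \<in> borel_measurable M" for k
      by (intro borel_measurable_scaleR borel_measurable_diff borel_measurable_const g_measurable \<sigma>(2) x)
        (use s in \<open>auto simp: less_imp_le\<close>)
  qed
qed (rule G_bound[OF _ x])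

text \<open>An error bound from convexity. Continue from \<open>\<zeta> t\<close> through
  \<open>\<zeta>' t\<close> to distance \<open>2 * r / 3\<close>; this endpoint is still within
  \<open>r\<close> of \<open>zb t\<close>, so a Slater selection exists above it. On the segment to
  that selection, the point above \<open>\<zeta>' t\<close> has weight \<open>3 / (2 * r)\<close>
  times the distance of \<open>\<zeta>' t\<close> from \<open>\<zeta> t\<close>, and
  \<open>y\<close> moves in proportion to this weight.\<close>

lemma correction:
  assumes [measurable]: "\<zeta> \<in> borel_measurable M" "\<zeta>' \<in> borel_measurable M"
    and near: "\<And>t. t \<in> space M \<Longrightarrow> norm (\<zeta> t - zb t) \<le> r / 3" "\<And>t. t \<in> space M \<Longrightarrow> norm (\<zeta>' t - zb t) \<le> r / 3"
    and y: "integrable M y" "AE t in M. (\<zeta> t, y t) \<in> S t"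
  obtains y' where "integrable M y'" "AE t in M. (\<zeta>' t, y' t) \<in> S t"
    and "AE t in M. norm (y' t - y t) \<le> norm (\<zeta>' t - \<zeta> t) * (3 / (2 * r)) * (K t + norm (y t))"
proof -
  define \<tau> where "\<tau> t = norm (\<zeta>' t - \<zeta> t) * (3 / (2 * r))" for t
  \<comment> \<open>Where \<open>\<tau> t = 0\<close>, also \<open>\<zeta>' t = \<zeta> t\<close>, and \<open>inverse 0 = 0\<close> makes \<open>h t\<close> harmless.\<close>
  define h where "h t = \<zeta> t - zb t + inverse (\<tau> t) *\<^sub>R (\<zeta>' t - \<zeta> t)" for t
  have hm: "h \<in> borel_measurable M" and [measurable]: "\<tau> \<in> borel_measurable M"
    unfolding h_def \<tau>_def by measurable
  have hr: "norm (h t) \<le> r" if "t \<in> space M" for t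
  proof -
    have "norm (inverse (\<tau> t) *\<^sub>R (\<zeta>' t - \<zeta> t)) \<le> 2 * r / 3"
      using r by (cases "\<zeta>' t = \<zeta> t") (auto simp: \<tau>_def)
    then show ?thesis using norm_triangle_ineq[of "\<zeta> t - zb t" "inverse (\<tau> t) *\<^sub>R (\<zeta>' t - \<zeta> t)"] near(1)[OF that]
      unfolding h_def by linarith
  qed
  have \<tau>: "0 \<le> \<tau> t" "\<tau> t \<le> 1" if "t \<in> space M" for t
  proof -
    have "norm (\<zeta>' t - \<zeta> t) \<le> 2 * r / 3"
      using norm_triangle_ineq4[of "\<zeta>' t - zb t" "\<zeta> t - zb t"] near[OF that] by simp
    then show "\<tau> t \<le> 1" using r by (simp add: \<tau>_def field_simps)
  qed (use r in \<open>simp add: \<tau>_def\<close>)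
  obtain q where q: "q \<in> borel_measurable M" "AE t in M. (zb t + h t, q t) \<in> S t \<and> norm (q t) \<le> K t"
    using sel[OF hm hr] by auto
  define y' where "y' t = (1 - \<tau> t) *\<^sub>R y t + \<tau> t *\<^sub>R q t" for t
  have dist: "norm (y' t - y t) \<le> \<tau> t * (K t + norm (y t))" if "t \<in> space M" "norm (q t) \<le> K t" for t
  proof -
    have "y' t - y t = \<tau> t *\<^sub>R (q t - y t)" by (simp add: y'_def algebra_simps)
    moreover have "norm (q t - y t) \<le> K t + norm (y t)" using norm_triangle_ineq4[of "q t" "y t"] that(2) by linarith
    ultimately show ?thesis using \<tau>[OF that(1)] by (simp add: mult_left_mono)
  qed
  have [measurable]: "y \<in> borel_measurable M" "q \<in> borel_measurable M" using y q by auto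
  show thesis
  proof
    have "integrable M (\<lambda>t. K t + norm (y t))" using K y by simp
    then have "integrable M (\<lambda>t. y' t - y t)"
    proof (rule Bochner_Integration.integrable_bound)
      show "(\<lambda>t. y' t - y t) \<in> borel_measurable M" unfolding y'_def by measurable
      show "AE t in M. norm (y' t - y t) \<le> norm (K t + norm (y t))"
        using q(2) AE_space
      proof eventually_elim
        case (elim t)
        have "\<tau> t * (K t + norm (y t)) \<le> 1 * (K t + norm (y t))"
          using \<tau>[OF elim(2)] K(2)[of t] by (intro mult_right_mono) auto
        then show ?case using dist[OF elim(2)] elim K(2)[of t] by simp
      qed
    qed
    from Bochner_Integration.integrable_add[OF this y(1)] show "integrable M y'" by simp
    show "AE t in M. (\<zeta>' t, y' t) \<in> S t"
      using q(2) y(2) AE_space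
    proof eventually_elim
      case (elim t)
      have "(1 - \<tau> t) *\<^sub>R (\<zeta> t, y t) + \<tau> t *\<^sub>R (zb t + h t, q t) \<in> S t"
        using elim \<tau>[OF elim(3)] by (intro convexD_alt[OF conv]) auto
      moreover have "(1 - \<tau> t) *\<^sub>R \<zeta> t + \<tau> t *\<^sub>R (zb t + h t) = \<zeta>' t"
      proof -
        have "(1 - \<tau> t) *\<^sub>R \<zeta> t + \<tau> t *\<^sub>R (zb t + h t) = \<zeta> t + (\<tau> t * inverse (\<tau> t)) *\<^sub>R (\<zeta>' t - \<zeta> t)"
          by (simp add: h_def algebra_simps)
        also have "\<dots> = \<zeta>' t" using r by (cases "\<zeta>' t = \<zeta> t") (auto simp: \<tau>_def)
        finally show ?thesis .
      qed
      ultimately show ?case by (simp add: y'_def)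
    qed
    show "AE t in M. norm (y' t - y t) \<le> norm (\<zeta>' t - \<zeta> t) * (3 / (2 * r)) * (K t + norm (y t))"
      using q(2) AE_space by eventually_elim (use dist in \<open>simp add: \<tau>_def\<close>)
  qed
qed

text \<open>Linearized feasibility has to become feasibility at \<open>x + s k *\<^sub>R u\<close>.
  The correction costs \<open>s k\<close> times a quantity with vanishing integral, so the
  integrated points approach along \<open>(u, integral\<^sup>L M v)\<close> and the sequential
  polarity of regular normals applies.\<close>

lemma regular_normal_key:
  assumes mem: "\<And>x' y'. x' \<in> U \<Longrightarrow> integrable M y' \<Longrightarrow> (AE t in M. (g t x', y' t) \<in> S t) \<Longrightarrow>
      (x', integral\<^sup>L M y') \<in> E"
    and normal: "(xs, - ys) \<in> regular_normal_cone (x, integral\<^sup>L M y) E" and x: "x \<in> U"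
    and y: "integrable M y" "AE t in M. (g t x, y t) \<in> S t"
    and v: "integrable M v" "AE t in M. (g t x + G x t u, y t + v t) \<in> S t"
  shows "xs \<bullet> u \<le> ys \<bullet> integral\<^sup>L M v"
proof -
  obtain \<sigma> where \<sigma>: "0 < \<sigma>" "\<sigma> \<le> 1" "\<sigma> * (L * norm u) \<le> r / 6"
    "\<And>s. 0 \<le> s \<Longrightarrow> s \<le> \<sigma> \<Longrightarrow> x + s *\<^sub>R u \<in> U"
    using admissible_step[OF x, of u] by metis
  define s where "s k = \<sigma> * inverse (real (Suc k))" for k
  have s: "\<And>k. s k > 0" "s \<longlonglongrightarrow> 0" "\<And>k. s k \<le> \<sigma>" "\<And>k. s k \<le> 1"
    using \<sigma> tendsto_mult[OF tendsto_const LIMSEQ_inverse_real_of_nat, of \<sigma>]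
    by (auto simp: s_def[abs_def] mult_le_cancel_left1 inverse_le_1_iff intro: mult_le_one)
  have xk: "x + s k *\<^sub>R u \<in> U" for k using \<sigma>(4) s by (simp add: less_imp_le)
  have [measurable]: "(\<lambda>t. g t x) \<in> borel_measurable M" "(\<lambda>t. g t (x + s k *\<^sub>R u)) \<in> borel_measurable M"
    "(\<lambda>t. G x t u) \<in> borel_measurable M" for k
    using g_measurable x xk bounded_measurableD[OF G_bounded_measurable[OF x]] by auto
  define yk where "yk k t = y t + s k *\<^sub>R v t" for k t
  have intyk: "integrable M (yk k)" for k unfolding yk_def using y v by simp
  define \<rho> where "\<rho> k t = norm ((g t (x + s k *\<^sub>R u) - g t x) /\<^sub>R s k - G x t u) * (3 / (2 * r))" for k t
  \<comment> \<open>A majorant free of \<open>k\<close>: since \<open>s k \<le> 1\<close>, it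
    dominates \<open>K t + norm (yk k t)\<close>.\<close>
  define H where "H t = K t + norm (y t) + norm (v t)" for t
  have ex: "\<exists>y'. integrable M y' \<and> (AE t in M. (g t (x + s k *\<^sub>R u), y' t) \<in> S t) \<and>
      (AE t in M. norm (y' t - yk k t) \<le> s k * (\<rho> k t * norm (H t)))" for k
  proof -
    have near: "norm (g t x + s k *\<^sub>R G x t u - zb t) \<le> r / 3" if "t \<in> space M" for t
    proof -
      have "norm (s k *\<^sub>R G x t u) \<le> \<sigma> * (L * norm u)"
        using s(1,3)[of k] G_bound[OF that x, of u] by (auto intro!: mult_mono simp: less_imp_le)
      then show ?thesis using \<sigma>(3) g_near[OF that x]
          norm_triangle_ineq[of "g t x - zb t" "s k *\<^sub>R G x t u"] by (simp add: algebra_simps)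
    qed
    have near': "norm (g t (x + s k *\<^sub>R u) - zb t) \<le> r / 3" if "t \<in> space M" for t
      using g_near[OF that xk, of k] r by linarith
    \<comment> \<open>The linearized pair is the convex combination with weight \<open>s k\<close>
      of the reference pair and the pair displaced by \<open>(G x t u, v t)\<close>.\<close>
    have ykS: "AE t in M. (g t x + s k *\<^sub>R G x t u, yk k t) \<in> S t"
      using y(2) v(2) AE_space
    proof eventually_elim
      case (elim t)
      from convexD_alt[OF conv[OF elim(3)] elim(1,2), of "s k"] s(1,4)[of k]
      show ?case by (simp add: yk_def algebra_simps)
    qed
    have m: "(\<lambda>t. g t x + s k *\<^sub>R G x t u) \<in> borel_measurable M" by measurable
    obtain y' where y': "integrable M y'" "AE t in M. (g t (x + s k *\<^sub>R u), y' t) \<in> S t"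
      "AE t in M. norm (y' t - yk k t) \<le> norm (g t (x + s k *\<^sub>R u) - (g t x + s k *\<^sub>R G x t u)) * (3 / (2 * r)) *
        (K t + norm (yk k t))"
      by (rule correction[OF m _ near near' intyk ykS]) auto
    have bound: "norm (y' t - yk k t) \<le> s k * (\<rho> k t * norm (H t))"
      if le: "norm (y' t - yk k t) \<le> norm (g t (x + s k *\<^sub>R u) - (g t x + s k *\<^sub>R G x t u)) * (3 / (2 * r)) *
        (K t + norm (yk k t))" for t
    proof -
      have "norm (s k *\<^sub>R v t) \<le> norm (v t)" using s(1,4)[of k] by (simp add: mult_left_le_one_le)
      then have H: "K t + norm (yk k t) \<le> norm (H t)"
        using norm_triangle_ineq[of "y t" "s k *\<^sub>R v t"] K(2)[of t] by (simp add: H_def yk_def)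
      have "g t (x + s k *\<^sub>R u) - (g t x + s k *\<^sub>R G x t u) = s k *\<^sub>R ((g t (x + s k *\<^sub>R u) - g t x) /\<^sub>R s k - G x t u)"
        using s(1)[of k] by (simp add: scaleR_diff_right)
      then have "norm (g t (x + s k *\<^sub>R u) - (g t x + s k *\<^sub>R G x t u)) * (3 / (2 * r)) = s k * \<rho> k t"
        using s(1)[of k] by (simp add: \<rho>_def)
      moreover have "0 \<le> s k * \<rho> k t" using s(1)[of k] r by (simp add: \<rho>_def)
      ultimately show ?thesis using le mult_left_mono[OF H, of "s k * \<rho> k t"] by (simp add: mult.assoc)
    qed
    from y'(3) have "AE t in M. norm (y' t - yk k t) \<le> s k * (\<rho> k t * norm (H t))"
      by eventually_elim (rule bound)
    with y'(1,2) show ?thesis by blast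
  qed
  from choice[OF allI[OF ex]] obtain y' where y0: "\<forall>k. integrable M (y' k) \<and>
      (AE t in M. (g t (x + s k *\<^sub>R u), y' k t) \<in> S t) \<and>
      (AE t in M. norm (y' k t - yk k t) \<le> s k * (\<rho> k t * norm (H t)))" ..
  have y': "\<And>k. integrable M (y' k)" "\<And>k. AE t in M. (g t (x + s k *\<^sub>R u), y' k t) \<in> S t"
    "\<And>k. AE t in M. norm (y' k t - yk k t) \<le> s k * (\<rho> k t * norm (H t))"
    using y0 by blast+
  define a where "a k t = (y' k t - yk k t) /\<^sub>R s k" for k t
  have inta: "integrable M (a k)" for k unfolding a_def using y'(1) intyk by simp
  have "(\<lambda>k. integral\<^sup>L M (a k)) \<longlonglongrightarrow> 0"
  proof (rule integral_tendsto_zero[OF inta])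
    show "integrable M H" unfolding H_def using K y v by simp
    show "AE t in M. norm (a k t) \<le> \<rho> k t * norm (H t)" for k
      using y'(3)[of k] by eventually_elim (use s(1)[of k] in
        \<open>simp add: a_def divide_inverse_commute[symmetric] pos_divide_le_eq mult.commute\<close>)
    show "(\<lambda>k. \<rho> k t) \<longlonglongrightarrow> 0" if "t \<in> space M" for t
      unfolding \<rho>_def
      by (intro tendsto_mult_left_zero tendsto_norm_zero LIM_zero difference_quotient_tendsto that x s)
    \<comment> \<open>The difference quotient and the derivative each contribute
      \<open>L * norm u\<close>.\<close>
    show "\<rho> k t \<le> 2 * (L * norm u) * (3 / (2 * r))" if t: "t \<in> space M" for k t
    proof -
      have "norm (g t (x + s k *\<^sub>R u) - g t x) \<le> s k * (L * norm u)"
        using g_lipschitz[OF t xk x, of k] s(1)[of k] by (simp add: mult_ac)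
      then have "norm ((g t (x + s k *\<^sub>R u) - g t x) /\<^sub>R s k) \<le> L * norm u"
        using s(1)[of k] by (simp add: divide_inverse_commute[symmetric] pos_divide_le_eq mult.commute)
      then have "norm ((g t (x + s k *\<^sub>R u) - g t x) /\<^sub>R s k - G x t u) \<le> 2 * (L * norm u)"
        using G_bound[OF t x, of u] by (intro order_trans[OF norm_triangle_ineq4]) simp
      then show ?thesis unfolding \<rho>_def using r by (intro mult_right_mono) auto
    qed
  qed
  then have "(\<lambda>k. (u, integral\<^sup>L M v + integral\<^sup>L M (a k))) \<longlonglongrightarrow> (u, integral\<^sup>L M v + 0)"
    by (intro tendsto_intros)
  moreover have "(x, integral\<^sup>L M y) + s k *\<^sub>R (u, integral\<^sup>L M v + integral\<^sup>L M (a k)) \<in> E" for k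
  proof -
    have "integral\<^sup>L M (a k) = (integral\<^sup>L M (y' k) - (integral\<^sup>L M y + s k *\<^sub>R integral\<^sup>L M v)) /\<^sub>R s k"
      unfolding a_def yk_def using y'(1) y v by simp
    then have "integral\<^sup>L M y + s k *\<^sub>R (integral\<^sup>L M v + integral\<^sup>L M (a k)) = integral\<^sup>L M (y' k)"
      using s(1)[of k] by (simp add: scaleR_add_right)
    then show ?thesis using mem[OF xk y'(1,2)] by simp
  qed
  ultimately have "(xs, - ys) \<bullet> (u, integral\<^sup>L M v + 0) \<le> 0"
    by (intro regular_normal_cone_sequential[OF normal s(1,2)])
  then show ?thesis by simp
qed

text \<open>A direction \<open>v\<close> feasible at the limit need not be feasible along the
  sequence. After scaling by \<open>e\<close>, the displaced limit selection is corrected to be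
  feasible at \<open>xk k\<close>, with a vanishing change of its integral. The inequalities for the
  corrected increments pass to the limit, and \<open>e\<close> cancels.\<close>

lemma key_limit:
  assumes xk: "\<And>k. xk k \<in> U" "xk \<longlonglongrightarrow> x" and x: "x \<in> U"
    and y: "\<And>k. integrable M (y k)" "(\<lambda>k. integral\<^sup>L M (y k)) \<longlonglongrightarrow> integral\<^sup>L M w"
    and w: "integrable M w" "AE t in M. (g t x, w t) \<in> S t"
    and lim: "xs \<longlonglongrightarrow> xs0" "ys \<longlonglongrightarrow> ys0"
    and cont: "\<And>t u. t \<in> space M \<Longrightarrow> (\<lambda>k. G (xk k) t u) \<longlonglongrightarrow> G x t u"
    and key: "\<And>k u v. integrable M v \<Longrightarrow> (AE t in M. (g t (xk k) + G (xk k) t u, y k t + v t) \<in> S t) \<Longrightarrow>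
      xs k \<bullet> u \<le> ys k \<bullet> integral\<^sup>L M v"
    and v: "integrable M v" "AE t in M. (g t x + G x t u, w t + v t) \<in> S t"
  shows "xs0 \<bullet> u \<le> ys0 \<bullet> integral\<^sup>L M v"
proof -
  obtain e where e: "0 < e" "e \<le> 1" "e * (L * norm u) \<le> r / 6"
    using admissible_step[OF x, of u] by metis
  define \<zeta> where "\<zeta> t = g t x + e *\<^sub>R G x t u" for t
  define \<zeta>' where "\<zeta>' k t = g t (xk k) + e *\<^sub>R G (xk k) t u" for k t
  define y0 where "y0 t = w t + e *\<^sub>R v t" for t
  have inty0: "integrable M y0" unfolding y0_def using w v by simp
  have [measurable]: "\<zeta> \<in> borel_measurable M" "\<zeta>' k \<in> borel_measurable M" for k
    unfolding \<zeta>_def \<zeta>'_def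
    using g_measurable x xk(1) bounded_measurableD[OF G_bounded_measurable] by auto
  have near: "norm (g t x + e *\<^sub>R G x t u - zb t) \<le> r / 3" if "t \<in> space M" "x \<in> U" for t x
  proof -
    have "norm (e *\<^sub>R G x t u) \<le> e * (L * norm u)"
      using e(1) G_bound[OF that, of u] by simp
    then show ?thesis using e(3) g_near[OF that]
        norm_triangle_ineq[of "g t x - zb t" "e *\<^sub>R G x t u"] by (simp add: algebra_simps)
  qed
  have y0S: "AE t in M. (\<zeta> t, y0 t) \<in> S t"
    using w(2) v(2) AE_space
  proof eventually_elim
    case (elim t)
    from convexD_alt[OF conv[OF elim(3)] elim(1,2), of e] e
    show ?case by (simp add: \<zeta>_def y0_def algebra_simps)
  qed
  define \<rho> where "\<rho> k t = norm (\<zeta>' k t - \<zeta> t) * (3 / (2 * r))" for k t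
  have ex: "\<exists>y'. integrable M y' \<and> (AE t in M. (\<zeta>' k t, y' t) \<in> S t) \<and>
      (AE t in M. norm (y' t - y0 t) \<le> \<rho> k t * (K t + norm (y0 t)))" for k
  proof (rule correction[of \<zeta> "\<zeta>' k" y0])
    show "norm (\<zeta> t - zb t) \<le> r / 3" "norm (\<zeta>' k t - zb t) \<le> r / 3" if "t \<in> space M" for t
      using near x xk(1) that by (auto simp: \<zeta>_def \<zeta>'_def)
    fix y' assume "integrable M y'" "AE t in M. (\<zeta>' k t, y' t) \<in> S t"
      "AE t in M. norm (y' t - y0 t) \<le> norm (\<zeta>' k t - \<zeta> t) * (3 / (2 * r)) * (K t + norm (y0 t))"
    then show ?thesis unfolding \<rho>_def by blast
  qed (use inty0 y0S in auto)
  from choice[OF allI[OF ex]] obtain y' where Y: "\<forall>k. integrable M (y' k) \<and>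
      (AE t in M. (\<zeta>' k t, y' k t) \<in> S t) \<and>
      (AE t in M. norm (y' k t - y0 t) \<le> \<rho> k t * (K t + norm (y0 t)))" ..
  have y': "\<And>k. integrable M (y' k)" "\<And>k. AE t in M. (\<zeta>' k t, y' k t) \<in> S t"
    "\<And>k. AE t in M. norm (y' k t - y0 t) \<le> \<rho> k t * (K t + norm (y0 t))"
    using Y by blast+
  have "(\<lambda>k. \<integral>t. y' k t - y0 t \<partial>M) \<longlonglongrightarrow> 0"
  proof (rule integral_tendsto_zero)
    show "integrable M (\<lambda>t. y' k t - y0 t)" for k using y'(1) inty0 by simp
    show "integrable M (\<lambda>t. K t + norm (y0 t))" using K inty0 by simp
    show "AE t in M. norm (y' k t - y0 t) \<le> \<rho> k t * norm (K t + norm (y0 t))" for k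
      using y'(3)[of k] by eventually_elim (use K(2) in simp)
    show "\<rho> k t \<le> (2 * r / 3) * (3 / (2 * r))" if t: "t \<in> space M" for k t
    proof -
      have "norm (\<zeta>' k t - \<zeta> t) \<le> 2 * r / 3"
        using norm_triangle_ineq4[of "\<zeta>' k t - zb t" "\<zeta> t - zb t"] near[OF t x] near[OF t xk(1), of k]
        by (simp add: \<zeta>_def \<zeta>'_def)
      then show ?thesis unfolding \<rho>_def using r by (intro mult_right_mono) auto
    qed
    show "(\<lambda>k. \<rho> k t) \<longlonglongrightarrow> 0" if t: "t \<in> space M" for t
    proof -
      have "isCont (g t) x" using g_derivative[OF t x] by (rule has_derivative_continuous)
      then have "(\<lambda>k. g t (xk k)) \<longlonglongrightarrow> g t x" using xk(2) by (rule isCont_tendsto_compose)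
      then have "(\<lambda>k. \<zeta>' k t) \<longlonglongrightarrow> \<zeta> t"
        unfolding \<zeta>_def \<zeta>'_def by (intro tendsto_intros cont t)
      then show ?thesis unfolding \<rho>_def by (intro tendsto_mult_left_zero tendsto_norm_zero LIM_zero)
    qed
  qed
  then have "(\<lambda>k. integral\<^sup>L M (y' k) - integral\<^sup>L M y0) \<longlonglongrightarrow> 0" using y'(1) inty0 by simp
  then have lim': "(\<lambda>k. integral\<^sup>L M (y' k)) \<longlonglongrightarrow> integral\<^sup>L M y0" by (simp add: LIM_zero_iff)
  have "xs k \<bullet> (e *\<^sub>R u) \<le> ys k \<bullet> (integral\<^sup>L M (y' k) - integral\<^sup>L M (y k))" for k
  proof -
    \<comment> \<open>The increment is measured from \<open>y k\<close> and not from
      \<open>w\<close>; for its integral, convergence of the integrals of \<open>y k\<close> is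
      enough.\<close>
    have "AE t in M. (g t (xk k) + G (xk k) t (e *\<^sub>R u), y k t + (y' k t - y k t)) \<in> S t"
      using y'(2)[of k] AE_space
      by eventually_elim (simp add: \<zeta>'_def linear_scale[OF G_linear] xk(1))
    from key[OF _ this] show ?thesis using y'(1) y(1) by simp
  qed
  then have "xs0 \<bullet> (e *\<^sub>R u) \<le> ys0 \<bullet> (integral\<^sup>L M y0 - integral\<^sup>L M w)"
    by (intro LIMSEQ_le[OF tendsto_inner[OF lim(1) tendsto_const]
          tendsto_inner[OF lim(2) tendsto_diff[OF lim' y(2)]]]) auto
  then have "e * (xs0 \<bullet> u) \<le> e * (ys0 \<bullet> integral\<^sup>L M v)"
    unfolding y0_def using w v by (simp add: inner_add_right)
  then show ?thesis using e(1) by simp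
qed

text \<open>Translation by \<open>(g t x, y t)\<close> moves the reference pair to 0. There a bound
  on a selection has to include \<open>norm (y t)\<close>.\<close>

lemma multiplier:
  assumes x: "x \<in> U" and y: "integrable M y" "AE t in M. (g t x, y t) \<in> S t"
    and interior: "AE t in M. interior (S t) \<noteq> {}"
    and meas: "\<And>a b. a \<in> borel_measurable M \<Longrightarrow> b \<in> borel_measurable M \<Longrightarrow> {t \<in> space M. (a t, b t) \<in> S t} \<in> sets M"
    and key: "\<And>u v. integrable M v \<Longrightarrow> (AE t in M. (g t x + G x t u, y t + v t) \<in> S t) \<Longrightarrow>
      xs \<bullet> u \<le> ys \<bullet> integral\<^sup>L M v"
  obtains z where "integrable M z"
    and "AE t in M. \<forall>q\<in>S t. (z t, - ys) \<bullet> (q - (g t x, y t)) \<le> 0"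
    and "\<And>u. (\<integral>t. z t \<bullet> G x t u \<partial>M) = xs \<bullet> u"
proof -
  define p where "p t = (g t x, y t)" for t
  define C where "C t = (\<lambda>q. q - p t) ` S t" for t
  have C: "q \<in> C t \<longleftrightarrow> p t + q \<in> S t" for q t
    unfolding C_def by (force simp: image_iff algebra_simps)
  have [measurable]: "y \<in> borel_measurable M" "(\<lambda>t. g t x) \<in> borel_measurable M"
    using y g_measurable[OF x] by auto
  obtain z where z: "integrable M z" "AE t in M. \<forall>q\<in>C t. (z t, - ys) \<bullet> q \<le> 0"
    "\<And>u. (\<integral>t. z t \<bullet> G x t u \<partial>M) = xs \<bullet> u"
  \<comment> \<open>The radius \<open>r / 2\<close> suffices: the offset of \<open>g t x\<close>
    from \<open>zb t\<close> adds at most \<open>r / 6\<close>, and the total stays below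
    \<open>r\<close>.\<close>
  proof (rule integral_multiplier[of "G x" C "r / 2" "\<lambda>t. K t + norm (y t)" xs ys])
    show "linear (G x t)" if "t \<in> space M" for t using G_linear[OF that x] .
    show "(\<lambda>t. G x t u) \<in> bounded_measurable M" for u by (rule G_bounded_measurable[OF x])
    show "convex (C t)" if "t \<in> space M" for t
      unfolding C_def using conv[OF that] by (simp add: convex_translation_subtract_eq)
    show "AE t in M. 0 \<in> C t" using y(2) by (simp add: C p_def)
    show "AE t in M. interior (C t) \<noteq> {}"
      using interior by eventually_elim (simp add: C_def interior_translation_subtract)
    show "{t \<in> space M. q \<in> C t} \<in> sets M" for q
      using meas[of "\<lambda>t. g t x + fst q" "\<lambda>t. y t + snd q"] by (cases q) (simp add: C p_def)
    show "r / 2 > 0" using r by simp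
    show "integrable M (\<lambda>t. K t + norm (y t))" using K y by simp
    show "0 \<le> K t + norm (y t)" for t using K(2)[of t] by simp
  next
    fix h :: "'t \<Rightarrow> 'z" assume [measurable]: "h \<in> borel_measurable M" and h: "\<And>t. t \<in> space M \<Longrightarrow> norm (h t) \<le> r / 2"
    have "(\<lambda>t. h t + (g t x - zb t)) \<in> borel_measurable M" by measurable
    moreover have "norm (h t + (g t x - zb t)) \<le> r" if "t \<in> space M" for t
      using norm_triangle_ineq[of "h t" "g t x - zb t"] h[OF that] g_near[OF that x] r by linarith
    ultimately obtain q where q: "q \<in> borel_measurable M"
      "AE t in M. (zb t + (h t + (g t x - zb t)), q t) \<in> S t \<and> norm (q t) \<le> K t"
      using sel by blast
    show "\<exists>q\<in>borel_measurable M. AE t in M. (h t, q t) \<in> C t \<and> norm (q t) \<le> K t + norm (y t)"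
    proof (rule bexI)
      show "(\<lambda>t. q t - y t) \<in> borel_measurable M" using q(1) by simp
      show "AE t in M. (h t, q t - y t) \<in> C t \<and> norm (q t - y t) \<le> K t + norm (y t)"
        using q(2)
      proof eventually_elim
        case (elim t)
        then show ?case using norm_triangle_ineq4[of "q t" "y t"] by (simp add: C p_def algebra_simps)
      qed
    qed
  next
    fix u v assume "integrable M v" "AE t in M. (G x t u, v t) \<in> C t"
    then show "xs \<bullet> u \<le> ys \<bullet> integral\<^sup>L M v" using key by (simp add: C p_def)
  qed blast
  show thesis
  proof
    show "AE t in M. \<forall>q\<in>S t. (z t, - ys) \<bullet> (q - (g t x, y t)) \<le> 0"
      using z(2) by (simp add: C_def p_def)
  qed (use z in auto)
qed

end

section \<open>The coderivatives of the expected map\<close>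

text \<open>The coordinates of the transposed image of \<open>z t\<close> are inner products of
  \<open>z t\<close> with \<open>J t *v b\<close>, so integrability follows from the action of
  \<open>J\<close> on fixed vectors. Testing against all \<open>u\<close> identifies the
  integral.\<close>

lemma aumann_integral_transposeI:
  fixes J :: "'t \<Rightarrow> real^'n^'q" and z :: "'t \<Rightarrow> real^'q"
  assumes z: "integrable M z" and J: "\<And>u. (\<lambda>t. J t *v u) \<in> bounded_measurable M"
    and xs: "\<And>u. (\<integral>t. z t \<bullet> (J t *v u) \<partial>M) = xs \<bullet> u"
    and A: "AE t in M. z t \<in> A t"
  shows "xs \<in> aumann_integral M (\<lambda>t. (\<lambda>zs. transpose (J t) *v zs) ` A t)"
proof -
  define v where "v t = transpose (J t) *v z t" for t
  have v_inner: "v t \<bullet> u = z t \<bullet> (J t *v u)" for t u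
    by (simp add: v_def dot_lmul_matrix flip: vector_transpose_matrix)
  have "integrable M (\<lambda>t. \<Sum>b\<in>Basis. (z t \<bullet> (J t *v b)) *\<^sub>R b)"
    by (intro Bochner_Integration.integrable_sum integrable_scaleR_left integrable_inner_bounded_measurable z J)
  moreover have "v t = (\<Sum>b\<in>Basis. (z t \<bullet> (J t *v b)) *\<^sub>R b)" for t
    using euclidean_representation[of "v t"] by (simp add: v_inner)
  ultimately have intv: "integrable M v" by (simp add: fun_eq_iff[symmetric] cong: Bochner_Integration.integrable_cong)
  have "integral\<^sup>L M v \<bullet> u = xs \<bullet> u" for u
    using integral_inner_left[of u M v] intv by (simp add: v_inner xs)
  then have "integral\<^sup>L M v = xs" by (metis vector_eq_rdot)
  moreover have "AE t in M. v t \<in> (\<lambda>zs. transpose (J t) *v zs) ` A t"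
    using A by eventually_elim (simp add: v_def)
  ultimately show ?thesis using intv unfolding aumann_integral_def by blast
qed

text \<open>L^1 convergence passes to the integrals, and along a subsequence to almost every
  \<open>t\<close>; there closedness of the graph at fixed \<open>t\<close> gives feasibility of the
  limit.\<close>

lemma L1_limit_selection:
  fixes \<Phi> :: "'t \<Rightarrow> 'x::topological_space \<Rightarrow> 'y::{banach, second_countable_topology} set"
  assumes closed: "\<And>t. t \<in> space M \<Longrightarrow> closed (gph (\<Phi> t))"
    and x: "x \<longlonglongrightarrow> x0" and y: "y \<longlonglongrightarrow> y0"
    and v: "\<And>k. v k \<in> selections M \<Phi> (x k) (y k)"
    and w: "integrable M w" and lim: "(\<lambda>k. \<integral>t. norm (v k t - w t) \<partial>M) \<longlonglongrightarrow> 0"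
  shows "w \<in> selections M \<Phi> x0 y0"
proof -
  have v': "integrable M (v k)" "integral\<^sup>L M (v k) = y k" "AE t in M. v k t \<in> \<Phi> t (x k)" for k
    using v by (auto simp: selections_def)
  have int: "integrable M (\<lambda>t. v k t - w t)" for k using v'(1) w by simp
  have "(\<lambda>k. \<integral>t. v k t - w t \<partial>M) \<longlonglongrightarrow> 0"
    by (rule Lim_null_comparison[OF _ lim]) (simp add: integral_norm_bound)
  then have "(\<lambda>k. y k - integral\<^sup>L M w) \<longlonglongrightarrow> 0" using v' w by simp
  then have "integral\<^sup>L M w = y0" using y by (simp add: LIM_zero_iff LIMSEQ_unique)
  moreover obtain s :: "nat \<Rightarrow> nat" where s: "strict_mono s" "AE t in M. (\<lambda>k. v (s k) t - w t) \<longlonglongrightarrow> 0"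
    using tendsto_L1_AE_subseq[OF int lim] by blast
  have "AE t in M. \<forall>k. v k t \<in> \<Phi> t (x k)" using v'(3) by (simp add: AE_all_countable)
  with s(2) AE_space have "AE t in M. w t \<in> \<Phi> t x0"
  proof eventually_elim
    case (elim t)
    have "(\<lambda>k. (x (s k), v (s k) t)) \<longlonglongrightarrow> (x0, w t)"
      using LIMSEQ_subseq_LIMSEQ[OF x s(1)] elim(1) by (intro tendsto_Pair) (auto simp: LIM_zero_iff o_def)
    moreover have "(x (s k), v (s k) t) \<in> gph (\<Phi> t)" for k using elim(3) by (simp add: gph_def)
    ultimately have "(x0, w t) \<in> gph (\<Phi> t)"
      by (intro Lim_in_closed_set[OF closed[OF elim(2)]]) auto
    then show ?case by (simp add: gph_def)
  qed
  ultimately show ?thesis using w by (simp add: selections_def)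
qed

theorem corollary6p7:
  fixes M :: "'t measure"
    and \<Phi> :: "'t \<Rightarrow> real^'n \<Rightarrow> (real^'m) set"
    and \<phi> :: "'i \<Rightarrow> 't \<Rightarrow> (real^'q) \<times> (real^'m) \<Rightarrow> real"
    and F :: "'t \<Rightarrow> real^'q \<Rightarrow> (real^'m) set"
    and g :: "'t \<Rightarrow> real^'n \<Rightarrow> real^'q"
    and I :: "'i set" and U :: "(real^'n) set"
    and xbar :: "real^'n" and ybar :: "real^'m"
    and \<rho> :: real and \<kappa> :: "'t \<Rightarrow> real"
  assumes complete: "complete_measure M" and finite: "finite_measure M"
    and normal: "set_valued_normal_integrand M \<Phi>"
    and ref: "(xbar, ybar) \<in> gph (expected_map M \<Phi>)"
    and \<rho>: "\<rho> > 0"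
    and \<kappa>: "integrable M \<kappa>" "\<forall>t\<in>space M. \<kappa> t > 0"
    and bounded: "\<forall>x\<in>cball xbar \<rho>. AE t in M. \<Phi> t x \<subseteq> cball 0 (\<kappa> t)"
    and U: "open U" "xbar \<in> U"
    and F: "F = sublevel_map I \<phi>"
    and repr: "\<forall>x\<in>U. AE t in M. \<Phi> t x = F t (g t x)"
    and I: "finite I"
    and \<phi>_integrand: "\<forall>i\<in>I. convex_normal_integrand M (\<phi> i)"
    and \<phi>_C1: "AE t in M. \<forall>\<^sub>F x in nhds xbar. \<forall>y \<in> F t (g t x). \<forall>i\<in>I. C1_around (\<phi> i t) (g t x, y)"
    and g_meas: "\<forall>x\<in>U. (\<lambda>t. g t x) \<in> borel_measurable M"
    and g_C1: "\<forall>t\<in>space M. C1_on (g t) U"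
    and g_bound: "bdd_above ((\<lambda>(t, x). onorm ((*v) (jacobian (g t) (at x)))) ` (space M \<times> U))"
    and itqc: "ITQC M I \<phi> g xbar"
    and slater: "integrable_slater M I \<phi> (\<lambda>t. g t xbar)"
  shows "(\<forall>yb \<in> selections M \<Phi> xbar ybar.
           (\<forall>ys. regular_coderivative (expected_map M \<Phi>) xbar ybar ys
              \<subseteq> aumann_integral M (\<lambda>t. (\<lambda>zs. transpose (jacobian (g t) (at xbar)) *v zs) `
                    limiting_coderivative (F t) (g t xbar) (yb t) ys)) \<and>
           (AE t in M. \<forall>ys. limiting_coderivative (F t) (g t xbar) (yb t) ys =
              {zs. \<exists>c. (\<forall>i\<in>active_indices I \<phi> g t xbar (yb t). c i \<ge> 0) \<and>
                 (zs, - ys) = (\<Sum>i\<in>active_indices I \<phi> g t xbar (yb t).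
                                 c i *\<^sub>R gradient (\<phi> i t) (g t xbar, yb t))}))
       \<and> (selections_inner_semicompact M \<Phi> xbar ybar \<longrightarrow>
           (\<forall>ys. limiting_coderivative (expected_map M \<Phi>) xbar ybar ys
              \<subseteq> (\<Union>yb \<in> selections M \<Phi> xbar ybar.
                   aumann_integral M (\<lambda>t. (\<lambda>zs. transpose (jacobian (g t) (at xbar)) *v zs) `
                     limiting_coderivative (F t) (g t xbar) (yb t) ys))))"
proof -
  interpret finite_measure M by (fact finite)
  define S where "S t = gph (F t)" for t
  have S: "(z, y) \<in> S t \<longleftrightarrow> (\<forall>i\<in>I. \<phi> i t (z, y) \<le> 0)" for z y t
    by (simp add: S_def gph_def F sublevel_map_def)
  have S': "S t = {q. \<forall>i\<in>I. \<phi> i t q \<le> 0}" for t by (auto simp: S)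
  have conv_\<phi>: "convex_on UNIV (\<phi> i t)" if "i \<in> I" "t \<in> space M" for i t
    using \<phi>_integrand that by (simp add: convex_normal_integrand_def)
  have conv_S: "convex (S t)" if "t \<in> space M" for t
  proof -
    have "convex {q. \<phi> i t q \<le> 0}" if i: "i \<in> I" for i
    proof (rule convexI)
      fix p q and a b :: real
      assume *: "p \<in> {q. \<phi> i t q \<le> 0}" "q \<in> {q. \<phi> i t q \<le> 0}" "0 \<le> a" "0 \<le> b" "a + b = 1"
      then have "\<phi> i t (a *\<^sub>R p + b *\<^sub>R q) \<le> a * \<phi> i t p + b * \<phi> i t q"
        using conv_\<phi>[OF i \<open>t \<in> space M\<close>] unfolding convex_on_def by blast
      also have "\<dots> \<le> 0" using * by (auto intro!: add_nonpos_nonpos mult_nonneg_nonpos)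
      finally show "a *\<^sub>R p + b *\<^sub>R q \<in> {q. \<phi> i t q \<le> 0}" by simp
    qed
    moreover have "S t = (\<Inter>i\<in>I. {q. \<phi> i t q \<le> 0})" by (auto simp: S')
    ultimately show ?thesis by (auto intro!: convex_INT)
  qed
  have deriv: "(g t has_derivative (\<lambda>h. jacobian (g t) (at x) *v h)) (at x)"
    if "t \<in> space M" "x \<in> U" for t x
  proof -
    have "g t differentiable (at x)"
      using g_C1 that unfolding C1_on_def differentiable_def by blast
    then show ?thesis by (simp add: jacobian_works)
  qed
  have jac_cont: "(\<lambda>k. jacobian (g t) (at (x k)) *v u) \<longlonglongrightarrow> jacobian (g t) (at x0) *v u"
    if t: "t \<in> space M" and x: "\<And>k. x k \<in> U" "x \<longlonglongrightarrow> x0" "x0 \<in> U" for t u x x0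
  proof -
    obtain f' where f': "continuous_on U f'" "\<And>x. x \<in> U \<Longrightarrow> (g t has_derivative blinfun_apply (f' x)) (at x)"
      using g_C1 t unfolding C1_on_def by blast
    have eq: "jacobian (g t) (at x) *v u = f' x u" if "x \<in> U" for x
      using has_derivative_unique[OF deriv[OF t that] f'(2)[OF that]] by metis
    have "(\<lambda>k. f' (x k)) \<longlonglongrightarrow> f' x0"
      using continuous_on_tendsto_compose[OF f'(1) x(2,3)] x(1) by simp
    then have "(\<lambda>k. f' (x k) u) \<longlonglongrightarrow> f' x0 u" by (intro tendsto_intros)
    then show ?thesis using x by (simp add: eq)
  qed
  obtain L0 where L0: "\<And>t x. t \<in> space M \<Longrightarrow> x \<in> U \<Longrightarrow> onorm ((*v) (jacobian (g t) (at x))) \<le> L0"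
    using g_bound unfolding bdd_above_def by force
  \<comment> \<open>Made strictly positive because the radius of the neighborhood divides by
    it.\<close>
  define L where "L = \<bar>L0\<bar> + 1"
  have L: "L > 0" "\<And>t x. t \<in> space M \<Longrightarrow> x \<in> U \<Longrightarrow> onorm ((*v) (jacobian (g t) (at x))) \<le> L"
    using L0 by (fastforce simp: L_def)+
  obtain \<eta> where \<eta>: "\<eta> > 0" "\<And>h. norm h \<le> \<eta> \<Longrightarrow> \<exists>y. integrable M y \<and>
      (AE t in M. \<forall>i\<in>I. \<phi> i t (g t xbar + h, y t) < 0)"
    using slater unfolding integrable_slater_def by auto
  have ex: "\<exists>y. integrable M y \<and> (AE t in M. (g t xbar + h, y t) \<in> S t)" if h: "norm h \<le> \<eta>" for h
  proof -
    obtain y where y: "integrable M y" "AE t in M. \<forall>i\<in>I. \<phi> i t (g t xbar + h, y t) < 0"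
      using \<eta>(2)[OF h] by blast
    from y(2) have "AE t in M. (g t xbar + h, y t) \<in> S t"
      by eventually_elim (auto simp: S less_imp_le)
    with y(1) show ?thesis by blast
  qed
  obtain r K where r: "r > 0" "integrable M K" "\<And>t. K t \<ge> 0"
    and sel: "\<And>h. h \<in> borel_measurable M \<Longrightarrow> (\<And>t. t \<in> space M \<Longrightarrow> norm (h t) \<le> r) \<Longrightarrow>
      \<exists>y\<in>borel_measurable M. AE t in M. (g t xbar + h t, y t) \<in> S t \<and> norm (y t) \<le> (K t :: real)"
    by (rule measurable_convex_selection[OF conv_S \<eta>(1) ex]) blast+
  obtain \<delta>0 where \<delta>0: "\<delta>0 > 0" "ball xbar \<delta>0 \<subseteq> U" using U open_contains_ball by blast
  \<comment> \<open>A convex neighborhood, so that the mean value inequality holds on it, and small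
    enough for the Lipschitz bound to give \<open>r / 6\<close>.\<close>
  define V where "V = ball xbar (min \<delta>0 (r / 6 / L))"
  have V: "open V" "convex V" "xbar \<in> V" "V \<subseteq> U"
    using \<delta>0 r L by (auto simp: V_def)
  have lip: "norm (g t x - g t x') \<le> L * norm (x - x')" if "t \<in> space M" "x \<in> V" "x' \<in> V" for t x x'
  proof (rule differentiable_bound[OF V(2) _ _ that(2,3)])
    fix x assume "x \<in> V"
    then have x: "x \<in> U" using V by blast
    show "(g t has_derivative (*v) (jacobian (g t) (at x))) (at x within V)"
      using deriv[OF that(1) x] by (rule has_derivative_at_withinI)
    show "onorm ((*v) (jacobian (g t) (at x))) \<le> L" by (rule L(2)[OF that(1) x])
  qed
  interpret slater_system M S "\<lambda>t. g t xbar" r K g "\<lambda>x t. (*v) (jacobian (g t) (at x))" V L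
  proof
    fix t x u assume *: "t \<in> space M" "x \<in> V"
    then have x: "x \<in> U" using V by blast
    show "(g t has_derivative (*v) (jacobian (g t) (at x))) (at x)" by (rule deriv[OF *(1) x])
    show "norm (jacobian (g t) (at x) *v u) \<le> L * norm u"
      using onorm[OF matrix_vector_mul_bounded_linear, of "jacobian (g t) (at x)" u]
        mult_right_mono[OF L(2)[OF *(1) x] norm_ge_zero, of u] by linarith
    have "L * norm (x - xbar) \<le> L * (r / 6 / L)"
      using *(2) L(1) by (intro mult_left_mono) (auto simp: V_def dist_norm norm_minus_commute)
    then show "norm (g t x - g t xbar) \<le> r / 6"
      using lip[OF * V(3)] L(1) by simp
  qed (use conv_S r sel V lip g_meas U in auto)
  have repr': "AE t in M. \<forall>y. y \<in> \<Phi> t x \<longleftrightarrow> (g t x, y) \<in> S t" if "x \<in> V" for x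
  proof -
    have "AE t in M. \<Phi> t x = F t (g t x)" using repr V that by blast
    then show ?thesis by eventually_elim (simp add: S_def gph_def)
  qed
  have selS: "integrable M v" "integral\<^sup>L M v = y" "AE t in M. (g t x, v t) \<in> S t"
    if v: "v \<in> selections M \<Phi> x y" and x: "x \<in> V" for v x y
  proof -
    show "integrable M v" "integral\<^sup>L M v = y" using v by (auto simp: selections_def)
    have "AE t in M. v t \<in> \<Phi> t x" using v by (auto simp: selections_def)
    with repr'[OF x] show "AE t in M. (g t x, v t) \<in> S t" by eventually_elim simp
  qed
  have mem: "(x, integral\<^sup>L M y) \<in> gph (expected_map M \<Phi>)"
    if x: "x \<in> V" and y: "integrable M y" "AE t in M. (g t x, y t) \<in> S t" for x y
  proof -
    have "AE t in M. y t \<in> \<Phi> t x" using repr'[OF x] y(2) by eventually_elim simp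
    then show ?thesis using y(1) by (auto simp: gph_def expected_map_def aumann_integral_def)
  qed
  \<comment> \<open>The Slater condition at shift 0: a strictly feasible point above
    \<open>g t xbar\<close>, used both for nonempty interior and for the multiplier formula.\<close>
  obtain y0 where y0: "AE t in M. \<forall>i\<in>I. \<phi> i t (g t xbar, y0 t) < 0" using \<eta>(2)[of 0] \<eta>(1) by auto
  have interior: "AE t in M. interior (S t) \<noteq> {}"
    using y0 AE_space
  proof eventually_elim
    case (elim t)
    \<comment> \<open>Finite convex functions on a finite-dimensional space are continuous.\<close>
    have "open (\<Inter>i\<in>I. {q. \<phi> i t q < 0})"
      using I convex_on_continuous[OF open_UNIV conv_\<phi>] elim(2)
      by (intro open_INT ballI open_Collect_less continuous_on_const) auto
    moreover have "(\<Inter>i\<in>I. {q. \<phi> i t q < 0}) \<subseteq> S t" by (auto simp: S' less_imp_le)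
    moreover have "(g t xbar, y0 t) \<in> (\<Inter>i\<in>I. {q. \<phi> i t q < 0})" using elim(1) by simp
    ultimately show ?case using interior_maximal by blast
  qed
  have meas: "{t \<in> space M. (a t, b t) \<in> S t} \<in> sets M"
    if [measurable]: "a \<in> borel_measurable M" "b \<in> borel_measurable M" for a b
  proof -
    have "(\<lambda>t. \<phi> i t (a t, b t)) \<in> borel_measurable M" if "i \<in> I" for i
    proof -
      have "(\<lambda>(t, q). \<phi> i t q) \<in> borel_measurable (M \<Otimes>\<^sub>M borel)"
        using \<phi>_integrand that by (simp add: convex_normal_integrand_def)
      moreover have "(\<lambda>t. (t, (a t, b t))) \<in> M \<rightarrow>\<^sub>M M \<Otimes>\<^sub>M borel"
        by (intro measurable_Pair1' measurable_Pair measurable_ident borel_measurable_Pair) auto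
      ultimately show ?thesis using measurable_compose by fastforce
    qed
    then have "{t \<in> space M. \<phi> i t (a t, b t) \<le> 0} \<in> sets M" if "i \<in> I" for i
      using that by measurable
    then show ?thesis unfolding S by (intro sets.sets_Collect_finite_All I)
  qed
  have cone: "limiting_normal_cone p (S t) = {n. \<forall>q\<in>S t. n \<bullet> (q - p) \<le> 0}"
    if "t \<in> space M" "p \<in> S t" for t p
    by (rule limiting_normal_cone_convex[OF conv_S[OF that(1)] that(2)])
  \<comment> \<open>Both inclusions end here; they differ only in how the key inequality at
    \<open>xbar\<close> is obtained.\<close>
  have conclude: "xs \<in> aumann_integral M (\<lambda>t. (\<lambda>zs. transpose (jacobian (g t) (at xbar)) *v zs) `
      limiting_coderivative (F t) (g t xbar) (yb t) ys)"
    if yb: "yb \<in> selections M \<Phi> xbar ybar"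
      and key: "\<And>u v. integrable M v \<Longrightarrow>
        (AE t in M. (g t xbar + jacobian (g t) (at xbar) *v u, yb t + v t) \<in> S t) \<Longrightarrow>
        xs \<bullet> u \<le> ys \<bullet> integral\<^sup>L M v"
    for xs ys yb
  proof -
    obtain z where z: "integrable M z"
      "AE t in M. \<forall>q\<in>S t. (z t, - ys) \<bullet> (q - (g t xbar, yb t)) \<le> 0"
      "\<And>u. (\<integral>t. z t \<bullet> (jacobian (g t) (at xbar) *v u) \<partial>M) = xs \<bullet> u"
      by (rule multiplier[OF V(3) selS(1,3)[OF yb V(3)] interior meas key]) blast+
    show ?thesis
    proof (rule aumann_integral_transposeI[OF z(1) G_bounded_measurable[OF V(3)] z(3)])
      show "AE t in M. z t \<in> limiting_coderivative (F t) (g t xbar) (yb t) ys"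
        using z(2) selS(3)[OF yb V(3)] AE_space
        by eventually_elim (simp add: limiting_coderivative_def cone flip: S_def)
    qed
  qed
  have formula: "AE t in M. \<forall>ys. limiting_coderivative (F t) (g t xbar) (yb t) ys =
      {zs. \<exists>c. (\<forall>i\<in>active_indices I \<phi> g t xbar (yb t). c i \<ge> 0) \<and>
        (zs, - ys) = (\<Sum>i\<in>active_indices I \<phi> g t xbar (yb t). c i *\<^sub>R gradient (\<phi> i t) (g t xbar, yb t))}"
    if yb: "yb \<in> selections M \<Phi> xbar ybar" for yb
    using \<phi>_C1 y0 selS(3)[OF yb V(3)] AE_space
  proof eventually_elim
    case (elim t)
    have "\<forall>y\<in>F t (g t xbar). \<forall>i\<in>I. C1_around (\<phi> i t) (g t xbar, y)"
      using eventually_nhds_x_imp_x[OF elim(1)] .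
    moreover have "yb t \<in> F t (g t xbar)" using elim(3) by (simp add: S_def gph_def)
    ultimately have D: "(\<phi> i t has_derivative (\<lambda>h. h \<bullet> gradient (\<phi> i t) (g t xbar, yb t))) (at (g t xbar, yb t))"
      if "i \<in> I" for i using that by (intro C1_around_gradient) blast
    have "n \<in> limiting_normal_cone (g t xbar, yb t) (gph (F t)) \<longleftrightarrow>
      (\<exists>c. (\<forall>i\<in>active_indices I \<phi> g t xbar (yb t). c i \<ge> 0) \<and>
        n = (\<Sum>i\<in>active_indices I \<phi> g t xbar (yb t). c i *\<^sub>R gradient (\<phi> i t) (g t xbar, yb t)))" for n
    proof -
      have "n \<in> limiting_normal_cone (g t xbar, yb t) (gph (F t)) \<longleftrightarrow>
          (\<forall>q. (\<forall>i\<in>I. \<phi> i t q \<le> 0) \<longrightarrow> n \<bullet> (q - (g t xbar, yb t)) \<le> 0)"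
        using cone[OF elim(4,3)] by (simp add: S' flip: S_def)
      also have "\<dots> \<longleftrightarrow> (\<exists>c. (\<forall>i\<in>active_indices I \<phi> g t xbar (yb t). c i \<ge> 0) \<and>
          n = (\<Sum>i\<in>active_indices I \<phi> g t xbar (yb t). c i *\<^sub>R gradient (\<phi> i t) (g t xbar, yb t)))"
        unfolding active_indices_def
        by (rule normals_inequality_system[OF I conv_\<phi>[OF _ elim(4)] _ _ D, where ?p0.0="(g t xbar, y0 t)"])
          (use elim(2,3) S in auto)
      finally show ?thesis .
    qed
    then show ?case by (auto simp: limiting_coderivative_def)
  qed
  have regular: "regular_coderivative (expected_map M \<Phi>) xbar ybar ys
      \<subseteq> aumann_integral M (\<lambda>t. (\<lambda>zs. transpose (jacobian (g t) (at xbar)) *v zs) `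
          limiting_coderivative (F t) (g t xbar) (yb t) ys)"
    if yb: "yb \<in> selections M \<Phi> xbar ybar" for yb ys
  proof
    fix xs assume "xs \<in> regular_coderivative (expected_map M \<Phi>) xbar ybar ys"
    then have n: "(xs, - ys) \<in> regular_normal_cone (xbar, integral\<^sup>L M yb) (gph (expected_map M \<Phi>))"
      using selS(2)[OF yb V(3)] by (simp add: regular_coderivative_def)
    show "xs \<in> aumann_integral M (\<lambda>t. (\<lambda>zs. transpose (jacobian (g t) (at xbar)) *v zs) `
        limiting_coderivative (F t) (g t xbar) (yb t) ys)"
      by (rule conclude[OF yb])
        (rule regular_normal_key[OF mem n V(3) selS(1,3)[OF yb V(3)]])
  qed
  have limiting: "\<exists>yb\<in>selections M \<Phi> xbar ybar. xs \<in> aumann_integral M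
      (\<lambda>t. (\<lambda>zs. transpose (jacobian (g t) (at xbar)) *v zs) ` limiting_coderivative (F t) (g t xbar) (yb t) ys)"
    if compact: "selections_inner_semicompact M \<Phi> xbar ybar"
      and xs: "xs \<in> limiting_coderivative (expected_map M \<Phi>) xbar ybar ys" for xs ys
  proof -
    obtain p n where p: "p \<longlonglongrightarrow> (xbar, ybar)" and n: "n \<longlonglongrightarrow> (xs, - ys)"
      and pn: "\<And>k::nat. n k \<in> regular_normal_cone (p k) (gph (expected_map M \<Phi>))"
      using xs unfolding limiting_coderivative_def limiting_normal_cone_def by blast
    have p1: "(\<lambda>k. fst (p k)) \<longlonglongrightarrow> xbar" and p2: "(\<lambda>k. snd (p k)) \<longlonglongrightarrow> ybar"
      using tendsto_fst[OF p] tendsto_snd[OF p] by simp_all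
    have "selections M \<Phi> (fst (p k)) (snd (p k)) \<noteq> {}" for k
    \<comment> \<open>The regular normal cone is empty off the set, so having a normal puts
      \<open>p k\<close> in the graph, and membership there is existence of a selection.\<close>
    proof -
      have "p k \<in> gph (expected_map M \<Phi>)"
        using pn[of k] by (auto simp: regular_normal_cone_def split: if_splits)
      then show ?thesis
        by (auto simp: gph_def expected_map_def aumann_integral_def selections_def)
    qed
    with compact p1 p2 have "\<exists>v. (\<forall>k. v k \<in> selections M \<Phi> (fst (p k)) (snd (p k))) \<and>
        (\<exists>r w. strict_mono r \<and> integrable M w \<and> (\<lambda>j. \<integral>t. norm (v (r j) t - w t) \<partial>M) \<longlonglongrightarrow> 0)"
      unfolding selections_inner_semicompact_def by simp
    then obtain v s w where v: "\<And>k. v k \<in> selections M \<Phi> (fst (p k)) (snd (p k))"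
      and s: "strict_mono s" and w: "integrable M w" "(\<lambda>j. \<integral>t. norm (v (s j) t - w t) \<partial>M) \<longlonglongrightarrow> 0"
      by blast
    note sub = LIMSEQ_subseq_LIMSEQ[OF _ s, unfolded o_def]
    have ws: "w \<in> selections M \<Phi> xbar ybar"
      by (rule L1_limit_selection[OF _ sub[OF p1] sub[OF p2] v w])
        (use normal in \<open>simp add: set_valued_normal_integrand_def\<close>)
    have "\<forall>\<^sub>F j in sequentially. fst (p (s j)) \<in> V"
      using topological_tendstoD[OF sub[OF p1] V(1,3)] .
    then obtain N where N: "\<forall>j\<ge>N. fst (p (s j)) \<in> V"
      unfolding eventually_sequentially by blast
    \<comment> \<open>Dropping the first \<open>N\<close> terms keeps every base point in
      \<open>V\<close>, where the key inequality is available.\<close>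
    define m where "m j = s (j + N)" for j
    have m: "strict_mono m" using s by (simp add: m_def strict_mono_def)
    have mV: "fst (p (m j)) \<in> V" for j using N by (simp add: m_def)
    note subm = LIMSEQ_subseq_LIMSEQ[OF _ m, unfolded o_def]
    note vm = selS[OF v mV]
    have lim_int: "(\<lambda>j. integral\<^sup>L M (v (m j))) \<longlonglongrightarrow> integral\<^sup>L M w"
      using subm[OF p2] selS(2)[OF ws V(3)] by (simp add: vm(2))
    have "xs \<bullet> u \<le> ys \<bullet> integral\<^sup>L M v0"
      if v0: "integrable M v0" "AE t in M. (g t xbar + jacobian (g t) (at xbar) *v u, w t + v0 t) \<in> S t" for u v0
    proof (rule key_limit[OF mV subm[OF p1] V(3) vm(1) lim_int selS(1,3)[OF ws V(3)] _ _ _ _ v0])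
      show "(\<lambda>j. fst (n (m j))) \<longlonglongrightarrow> xs" "(\<lambda>j. - snd (n (m j))) \<longlonglongrightarrow> ys"
        using tendsto_fst[OF subm[OF n]] tendsto_minus[OF tendsto_snd[OF subm[OF n]]] by simp_all
      show "(\<lambda>k. jacobian (g t) (at (fst (p (m k)))) *v u) \<longlonglongrightarrow> jacobian (g t) (at xbar) *v u"
        if "t \<in> space M" for t u
        using mV V by (intro jac_cont that subm[OF p1]) auto
      fix j u v1 assume v1: "integrable M v1"
        "AE t in M. (g t (fst (p (m j))) + jacobian (g t) (at (fst (p (m j)))) *v u, v (m j) t + v1 t) \<in> S t"
      \<comment> \<open>The double negation gives the normal the form \<open>(xs, - ys)\<close>,
        with \<open>ys\<close> replaced by \<open>- snd (n (m j))\<close>.\<close>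
      have "(fst (n (m j)), - (- snd (n (m j)))) \<in>
          regular_normal_cone (fst (p (m j)), integral\<^sup>L M (v (m j))) (gph (expected_map M \<Phi>))"
        using pn[of "m j"] by (simp add: vm(2))
      from regular_normal_key[OF mem this mV vm(1,3) v1]
      show "fst (n (m j)) \<bullet> u \<le> - snd (n (m j)) \<bullet> integral\<^sup>L M v1" .
    qed
    then show ?thesis using conclude[OF ws] ws by blast
  qed
  show ?thesis using formula regular limiting by blast
qed

end
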